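(* Let $\nu,d\in\mathbb{N}$, let $\Psi$ be a real symmetric positive definite $\nu\times\nu$ matrix and $\Sigma$ a real symmetric positive definite $d\times d$ matrix. Let $(\mathcal{P}^{\mathrm{OU}}_t)_{t\ge0}$ be the transition semigroup of the matrix Ornstein--Uhlenbeck process $\mathrm{d}\mathfrak{X}_t=-\mathfrak{X}_t\,\mathrm{d}t+\sqrt2\,\Psi^{1/2}\,\mathrm{d}\mathfrak{B}_t\,\Sigma^{1/2}$, with stationary limiting distribution $\gamma=\mathcal{N}_{\nu\times d}(0_{\nu\times d},\Psi\otimes\Sigma)$, and let $\mathfrak{X}_\infty\sim\gamma$. For every test function $h$ belonging either to $C^{0,\alpha}(\mathbb{R}^{\nu\times d})$ for some $\alpha\in(0,1]$, or to $\mathrm{Lip}_p(\mathbb{R}^{\nu\times d})$ for some $p\in\mathbb{N}\cup\{0\}$, the function $$f_h(X)=-\int_0^\infty\Big\{\mathcal{P}^{\mathrm{OU}}_th(X)-\mathsf{E}[h(\mathfrak{X}_\infty)]\Big\}\,\mathrm{d}t,\qquad X\in\mathbb{R}^{\nu\times d},$$ is well defined pointwise and solves the matrix normal Stein equation $\mathcal{A}^{\mathrm{OU}}f_h(X)=h(X)-\mathsf{E}[h(\mathfrak{X}_\infty)]$ in the pointwise semigroup-generator sense, i.e., for every $X\in\mathbb{R}^{\nu\times d}$, $$\lim_{s\downarrow0}\frac{\mathcal{P}^{\mathrm{OU}}_sf_h(X)-f_h(X)}{s}=h(X)-\mathsf{E}[h(\mathfrak{X}_\infty)].$$ Moreover,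 if $h\in C^{0,\alpha}(\mathbb{R}^{\nu\times d})$ for some $\alpha\in(0,1]$, then for every $X\in\mathbb{R}^{\nu\times d}$, $$|f_h(X)|\le\alpha^{-1}[h]_\alpha\,d_{\mathrm{HK},\alpha}(\delta_X,\gamma)\le\alpha^{-1}[h]_\alpha\Big\{\mathsf{E}\big[\|\mathfrak{X}_\infty\|_F^\alpha\big]+\|X\|_F^\alpha\Big\},$$ where $\delta_X$ is the point mass at $X$.
   Context: $\|A\|_F=\sqrt{\mathrm{tr}(A^\top A)}$ is the Frobenius norm. $S^{1/2}$ is the symmetric square root. $(\mathfrak{B}_t)_{t\ge0}$ is a $\nu\times d$ matrix of independent standard Brownian motions. $\mathfrak{N}\sim\mathcal{N}_{\nu\times d}(M,\Psi\otimes\Sigma)$ means $\mathrm{vec}(\mathfrak{N}^\top)\sim\mathcal{N}_{\nu d}(\mathrm{vec}(M^\top),\Psi\otimes\Sigma)$ ($\mathrm{vec}$ stacks columns, $\otimes$ is the Kronecker product). The semigroup is $\mathcal{P}^{\mathrm{OU}}_th(X)=\mathsf{E}[h(\mathfrak{X}_t)\mid\mathfrak{X}_0=X]$, explicitly $\mathcal{P}^{\mathrm{OU}}_th(X)=\mathsf{E}[h(e^{-t}X+\sqrt{1-e^{-2t}}\,\Psi^{1/2}\mathfrak{Z}\Sigma^{1/2})]$ with $\mathfrak{Z}\sim\mathcal{N}_{\nu\times d}(0_{\nu\times d},I_\nu\otimes I_d)$. For $\alpha\in(0,1]$ and $h:\mathbb{R}^{\nu\times d}\to\mathbb{R}$,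 $[h]_\alpha=\sup_{X\ne Y}|h(X)-h(Y)|/\|X-Y\|_F^\alpha$ and $C^{0,\alpha}(\mathbb{R}^{\nu\times d})=\{h:[h]_\alpha<\infty\}$. For $p\in\mathbb{N}\cup\{0\}$, $\mathrm{Lip}_p(\mathbb{R}^{\nu\times d})$ is the class of functions $h:\mathbb{R}^{\nu\times d}\to\mathbb{R}$ whose partial derivatives up to order $p$ exist (the zeroth-order derivative being the function itself) and whose partial derivatives of order $p$ all belong to $C^{0,1}(\mathbb{R}^{\nu\times d})$. The $\alpha$-H\"older--Kantorovich distance between probability measures on $\mathbb{R}^{\nu\times d}$ is $$d_{\mathrm{HK},\alpha}(\mu,\eta)=\sup\Big\{\Big|\int g\,\mathrm{d}\mu-\int g\,\mathrm{d}\eta\Big|:\ g\in C^{0,\alpha}(\mathbb{R}^{\nu\times d}),\ [g]_\alpha\le1\Big\}.$$ *)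

theory Defs
  imports "HOL-Probability.Probability"
begin

definition sym_pos_def :: "real^'k^'k \<Rightarrow> bool" where
  "sym_pos_def S \<longleftrightarrow> transpose S = S \<and> (\<forall>v. v \<noteq> 0 \<longrightarrow> 0 < v \<bullet> (S *v v))"

text \<open>The principal square root: the unique symmetric positive semidefinite one.\<close>

definition sym_sqrt :: "real^'k^'k \<Rightarrow> real^'k^'k" where
  "sym_sqrt S = (THE R. transpose R = R \<and> (\<forall>v. 0 \<le> v \<bullet> (R *v v)) \<and> R ** R = S)"

definition frobenius_norm :: "real^'d^'n \<Rightarrow> real" where
  "frobenius_norm A = sqrt (trace (transpose A ** A))"

lemma frobenius_norm_eq_norm: "frobenius_norm A = norm A"
proof -
  have "trace (transpose A ** A) = (\<Sum>i\<in>UNIV. \<Sum>j\<in>UNIV. (A $ i $ j)\<^sup>2)"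
    by (subst sum.swap)
       (simp add: trace_def matrix_matrix_mult_def transpose_def power2_eq_square)
  also have "\<dots> = (norm A)\<^sup>2"
    unfolding power2_norm_eq_inner inner_vec_def by (simp add: power2_eq_square)
  finally show ?thesis
    by (simp add: frobenius_norm_def)
qed

text \<open>
  Vectors of length $\nu d$ are indexed by pairs, with the index $(i,j)$ standing for position
  $(i-1)d+j$.  Stacking the columns of the transpose of $A$ puts the entry $A_{ij}$ there, and
  the entry of the Kronecker product at row $(i,j)$ and column $(k,l)$ is $\Psi_{ik}\Sigma_{jl}$.
\<close>

definition vec_transpose :: "real^'d^'n \<Rightarrow> real^('n \<times> 'd)" where
  "vec_transpose A = (\<chi> p. A $ fst p $ snd p)"

definition unvec_transpose :: "real^('n \<times> 'd) \<Rightarrow> real^'d^'n" where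
  "unvec_transpose v = (\<chi> i j. v $ (i, j))"

definition kronecker :: "real^'n^'n \<Rightarrow> real^'d^'d \<Rightarrow> real^('n \<times> 'd)^('n \<times> 'd)" where
  "kronecker P S = (\<chi> p q. P $ fst p $ fst q * S $ snd p $ snd q)"

lemma unvec_vec_transpose [simp]: "unvec_transpose (vec_transpose A) = A"
  by (simp add: vec_transpose_def unvec_transpose_def vec_eq_iff)

lemma vec_unvec_transpose [simp]: "vec_transpose (unvec_transpose v) = v"
  by (simp add: vec_transpose_def unvec_transpose_def vec_eq_iff)

lemma measurable_vec_transpose [measurable]: "vec_transpose \<in> borel \<rightarrow>\<^sub>M borel"
  unfolding vec_transpose_def
  by (intro borel_measurable_continuous_onI continuous_intros)

lemma measurable_unvec_transpose [measurable]: "unvec_transpose \<in> borel \<rightarrow>\<^sub>M borel"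
  unfolding unvec_transpose_def
  by (intro borel_measurable_continuous_onI continuous_intros)

text \<open>Only meaningful for a symmetric positive definite covariance matrix.\<close>

definition multivariate_normal :: "real^'k \<Rightarrow> real^'k^'k \<Rightarrow> (real^'k) measure" where
  "multivariate_normal m C = density lborel (\<lambda>x. ennreal
     (exp (- ((x - m) \<bullet> (matrix_inv C *v (x - m))) / 2) / sqrt ((2 * pi) ^ CARD('k) * det C)))"

text \<open>The law of a matrix whose transpose has the vectorisation distributed as
  \<^term>\<open>multivariate_normal (vec_transpose M) (kronecker P S)\<close>.\<close>

definition matrix_normal ::
    "real^'d^'n \<Rightarrow> real^'n^'n \<Rightarrow> real^'d^'d \<Rightarrow> (real^'d^'n) measure" where
  "matrix_normal M P S =
     distr (multivariate_normal (vec_transpose M) (kronecker P S)) borel unvec_transpose"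

lemma distr_vec_matrix_normal:
  "distr (matrix_normal M P S) borel vec_transpose =
     multivariate_normal (vec_transpose M) (kronecker P S)"
proof -
  have *: "unvec_transpose \<in> multivariate_normal (vec_transpose M) (kronecker P S) \<rightarrow>\<^sub>M borel"
    by (simp add: multivariate_normal_def)
  have "distr (matrix_normal M P S) borel vec_transpose =
      distr (multivariate_normal (vec_transpose M) (kronecker P S)) borel (\<lambda>v. v)"
    unfolding matrix_normal_def
    by (subst distr_distr[OF measurable_vec_transpose *]) (simp add: comp_def)
  also have "\<dots> = multivariate_normal (vec_transpose M) (kronecker P S)"
    by (intro distr_id2) (simp add: multivariate_normal_def)
  finally show ?thesis .
qed

text \<open>The seminorm and the distance below are extended-valued, so that an unbounded supremum is
  infinite rather than an unspecified real number.\<close>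

definition hoelder_seminorm :: "real \<Rightarrow> (real^'d^'n \<Rightarrow> real) \<Rightarrow> ennreal" where
  "hoelder_seminorm \<alpha> h =
     (SUP (X, Y) \<in> {(X, Y). X \<noteq> Y}. ennreal (\<bar>h X - h Y\<bar> / frobenius_norm (X - Y) powr \<alpha>))"

definition hoelder_space :: "real \<Rightarrow> (real^'d^'n \<Rightarrow> real) set" where
  "hoelder_space \<alpha> = {h. hoelder_seminorm \<alpha> h < \<infinity>}"

definition unit_matrix :: "'n \<times> 'd \<Rightarrow> real^'d^'n" where
  "unit_matrix p = axis (fst p) (axis (snd p) 1)"

definition has_partial_at :: "'n \<times> 'd \<Rightarrow> (real^'d^'n \<Rightarrow> real) \<Rightarrow> real^'d^'n \<Rightarrow> bool" where
  "has_partial_at p h X \<longleftrightarrow> (\<lambda>t::real. h (X + t *\<^sub>R unit_matrix p)) differentiable (at 0)"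

definition partial_deriv :: "'n \<times> 'd \<Rightarrow> (real^'d^'n \<Rightarrow> real) \<Rightarrow> real^'d^'n \<Rightarrow> real" where
  "partial_deriv p h X = deriv (\<lambda>t::real. h (X + t *\<^sub>R unit_matrix p)) 0"

fun iterated_partial ::
    "('n \<times> 'd) list \<Rightarrow> (real^'d^'n \<Rightarrow> real) \<Rightarrow> real^'d^'n \<Rightarrow> real" where
  "iterated_partial [] h = h"
| "iterated_partial (p # ps) h = partial_deriv p (iterated_partial ps h)"

definition Lip_class :: "nat \<Rightarrow> (real^'d^'n \<Rightarrow> real) set" where
  "Lip_class k = {h.
     (\<forall>ps p X. length ps < k \<longrightarrow> has_partial_at p (iterated_partial ps h) X) \<and>
     (\<forall>ps. length ps = k \<longrightarrow> iterated_partial ps h \<in> hoelder_space 1)}"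

definition hoelder_kantorovich_dist ::
    "real \<Rightarrow> (real^'d^'n) measure \<Rightarrow> (real^'d^'n) measure \<Rightarrow> ennreal" where
  "hoelder_kantorovich_dist \<alpha> \<mu> \<eta> =
     (SUP g \<in> {g \<in> hoelder_space \<alpha>. hoelder_seminorm \<alpha> g \<le> 1}.
        ennreal \<bar>(\<integral>X. g X \<partial>\<mu>) - (\<integral>X. g X \<partial>\<eta>)\<bar>)"

abbreviation std_matrix_normal :: "(real^'d^'n) measure" where
  "std_matrix_normal \<equiv> matrix_normal 0 (mat 1) (mat 1)"

text \<open>
  The strong solution of $dX_t = -X_t\,dt + \sqrt2\,\Psi^{1/2}\,dB_t\,\Sigma^{1/2}$ started at $X$
  has at time $t$ the law of \<open>ou_state \<Psi> \<Sigma> t X Z\<close> with $Z$ standard matrix normal.  The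
  semigroup is defined through this explicit (Mehler) form of the conditional expectation.
\<close>

definition ou_state ::
    "real^'n^'n \<Rightarrow> real^'d^'d \<Rightarrow> real \<Rightarrow> real^'d^'n \<Rightarrow> real^'d^'n \<Rightarrow> real^'d^'n" where
  "ou_state \<Psi> \<Sigma> t X Z =
     exp (- t) *\<^sub>R X + sqrt (1 - exp (- 2 * t)) *\<^sub>R (sym_sqrt \<Psi> ** Z ** sym_sqrt \<Sigma>)"

definition ou_semigroup ::
    "real^'n^'n \<Rightarrow> real^'d^'d \<Rightarrow> real \<Rightarrow> (real^'d^'n \<Rightarrow> real) \<Rightarrow> real^'d^'n \<Rightarrow> real" where
  "ou_semigroup \<Psi> \<Sigma> t h X = (\<integral>Z. h (ou_state \<Psi> \<Sigma> t X Z) \<partial>std_matrix_normal)"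

abbreviation ou_stationary :: "real^'n^'n \<Rightarrow> real^'d^'d \<Rightarrow> (real^'d^'n) measure" where
  "ou_stationary \<Psi> \<Sigma> \<equiv> matrix_normal 0 \<Psi> \<Sigma>"

definition stein_solution ::
    "real^'n^'n \<Rightarrow> real^'d^'d \<Rightarrow> (real^'d^'n \<Rightarrow> real) \<Rightarrow> real^'d^'n \<Rightarrow> real" where
  "stein_solution \<Psi> \<Sigma> h X =
     - (LBINT t:{0..}. ou_semigroup \<Psi> \<Sigma> t h X - (\<integral>Y. h Y \<partial>ou_stationary \<Psi> \<Sigma>))"

end

theory Submission
  imports Defs
begin

text \<open>
  The stationary law \<open>\<gamma>\<close> is a linear image of a standard Gaussian, so the rotation invariance of
  the latter gives \<open>a Y + b Y' \<sim> \<gamma>\<close> for independent \<open>Y, Y' \<sim> \<gamma>\<close> and \<open>a\<^sup>2 + b\<^sup>2 = 1\<close>.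
  This stability and the finiteness of all moments are all that is used of \<open>\<gamma>\<close>.
  Stability yields the semigroup property and, by driving two starting points \<open>X\<close> and \<open>Y' \<sim> \<gamma>\<close>
  with the same noise, the exponential decay of \<open>\<phi>(t) = P\<^sub>t h X - \<integral>h d\<gamma>\<close> for
  test functions with a polynomially weighted Hoelder bound.  Hence by Fubini
  \<open>P\<^sub>s f X - f X\<close> is the integral of \<open>\<phi>\<close> over \<open>[0, s]\<close>, and the right
  continuity of \<open>\<phi>\<close> at \<open>0\<close> gives the Stein equation.
\<close>

subsection \<open>Lebesgue measure under linear bijections\<close>

text \<open>\<open>multivariate_normal\<close> is given by a density containing \<open>det\<close>
  and \<open>matrix_inv\<close>, so reading it as a linear image of a standard Gaussian takes a
  change of variables with the exact Jacobian. \<open>sym_sqrt\<close> is a definite description,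
  hence existence and uniqueness of the root come before any computation with it. Functions in
  \<open>Lip_class\<close> may grow like a power of the norm, so no uniform Lipschitz constant is
  available. Their increments are bounded with the factor \<open>(weight X * weight Y) ^ p\<close>.
  Weights are submultiplicative under combinations with coefficients of modulus at most one, so
  start, coupled start and noise separate into factors that the moments integrate. The coupling
  yields a constant made of moments, too crude for the bound by the Hoelder-Kantorovich distance.
  For that bound the decay is derived anew, testing the distance with \<open>mehler t h\<close>
  instead of h; the integral of \<open>exp (- \<alpha> * t)\<close> over the half-line is the factor
  \<open>1 / \<alpha>\<close>.\<close>

lemma nn_integral_lborel_translate:
  fixes g :: "'a::euclidean_space \<Rightarrow> ennreal"
  assumes [measurable]: "g \<in> borel_measurable borel"
  shows "(\<integral>\<^sup>+x. g (c + x) \<partial>lborel) = (\<integral>\<^sup>+x. g x \<partial>lborel)"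
proof -
  have "(\<integral>\<^sup>+x. g x \<partial>lborel) = (\<integral>\<^sup>+x. g x \<partial>distr lborel borel ((+) c))"
    by (simp add: lborel_distr_plus)
  also have "\<dots> = (\<integral>\<^sup>+x. g (c + x) \<partial>lborel)"
    by (rule nn_integral_distr) auto
  finally show ?thesis by simp
qed

lemma borel_measurable_linear:
  fixes T :: "'a::euclidean_space \<Rightarrow> 'b::euclidean_space"
  assumes "linear T"
  shows "T \<in> borel \<rightarrow>\<^sub>M borel"
  by (intro borel_measurable_continuous_onI linear_continuous_on linear_conv_bounded_linear[THEN iffD1] assms)

text \<open>For injective linear T this is the reciprocal of the absolute determinant, here as the
  volume of a preimage of the unit box. The sign is the one that the Tonelli computation below
  leaves behind.\<close>

definition inv_modulus :: "('a::euclidean_space \<Rightarrow> 'a) \<Rightarrow> ennreal" where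
  "inv_modulus T = (\<integral>\<^sup>+x. indicator (box 0 One) (- T x) \<partial>lborel)"

lemma nn_integral_unit_box:
  "(\<integral>\<^sup>+x. indicator (box 0 One) x \<partial>(lborel :: 'a::euclidean_space measure)) = 1"
  by (simp add: emeasure_lborel_box_eq inner_Basis)

text \<open>Uniqueness of the translation invariant measure, by Tonelli: integrate
  \<open>g (T y) * indicator B (x - T y)\<close>, with \<open>B\<close> the unit box, in both orders.\<close>

lemma nn_integral_lborel_linear:
  fixes T :: "'a::euclidean_space \<Rightarrow> 'a" and g :: "'a \<Rightarrow> ennreal"
  assumes T: "linear T" "inj T" and g[measurable]: "g \<in> borel_measurable borel"
  shows "(\<integral>\<^sup>+x. g (T x) \<partial>lborel) = inv_modulus T * (\<integral>\<^sup>+x. g x \<partial>lborel)"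
proof -
  note [measurable] = borel_measurable_linear[OF T(1)]
  let ?B = "indicator (box 0 One) :: 'a \<Rightarrow> ennreal"
  have surj: "surj T" using T linear_injective_imp_surjective by blast
  have B: "(\<integral>\<^sup>+x. ?B (x - c) \<partial>lborel) = 1" for c
  proof -
    have "(\<integral>\<^sup>+x. ?B (x - c) \<partial>lborel) = (\<integral>\<^sup>+x. ?B (- c + x) \<partial>lborel)" by simp
    also have "\<dots> = (\<integral>\<^sup>+x. ?B x \<partial>lborel)"
      by (rule nn_integral_lborel_translate) simp
    finally show ?thesis by (simp only: nn_integral_unit_box)
  qed
  have "(\<integral>\<^sup>+y. g (T y) \<partial>lborel) = (\<integral>\<^sup>+y. g (T y) * (\<integral>\<^sup>+x. ?B (x - T y) \<partial>lborel) \<partial>lborel)"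
    by (simp only: B) simp
  also have "\<dots> = (\<integral>\<^sup>+y. \<integral>\<^sup>+x. g (T y) * ?B (x - T y) \<partial>lborel \<partial>lborel)"
    by (simp add: nn_integral_cmult)
  also have "\<dots> = (\<integral>\<^sup>+x. \<integral>\<^sup>+y. g (T y) * ?B (x - T y) \<partial>lborel \<partial>lborel)"
    by (rule lborel_pair.Fubini') simp
  also have "\<dots> = (\<integral>\<^sup>+x. \<integral>\<^sup>+y. g (x + T y) * ?B (- T y) \<partial>lborel \<partial>lborel)"
  proof (rule nn_integral_cong)
    fix x
    \<comment> \<open>As T is onto, a shift by x in the range is a shift by z in the domain:
      replacing y by z + y turns \<open>x - T y\<close> into \<open>- T y\<close>.\<close>
    obtain z where z: "x = T z" using surj by blast
    show "(\<integral>\<^sup>+y. g (T y) * ?B (x - T y) \<partial>lborel) = (\<integral>\<^sup>+y. g (x + T y) * ?B (- T y) \<partial>lborel)"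
      by (subst nn_integral_lborel_translate[symmetric, of _ z]) (simp_all add: z linear_add[OF T(1)])
  qed
  also have "\<dots> = (\<integral>\<^sup>+y. \<integral>\<^sup>+x. g (x + T y) * ?B (- T y) \<partial>lborel \<partial>lborel)"
    by (rule lborel_pair.Fubini') simp
  also have "\<dots> = (\<integral>\<^sup>+y. (\<integral>\<^sup>+x. g x \<partial>lborel) * ?B (- T y) \<partial>lborel)"
  proof (rule nn_integral_cong)
    fix y
    have "(\<integral>\<^sup>+x. g (x + T y) * ?B (- T y) \<partial>lborel) = (\<integral>\<^sup>+x. g (T y + x) \<partial>lborel) * ?B (- T y)"
      by (subst nn_integral_multc) (simp_all add: add.commute)
    then show "(\<integral>\<^sup>+x. g (x + T y) * ?B (- T y) \<partial>lborel) = (\<integral>\<^sup>+x. g x \<partial>lborel) * ?B (- T y)"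
      by (simp add: nn_integral_lborel_translate)
  qed
  also have "\<dots> = (\<integral>\<^sup>+x. g x \<partial>lborel) * inv_modulus T"
    unfolding inv_modulus_def by (rule nn_integral_cmult) simp
  finally show ?thesis by (simp add: mult.commute)
qed

lemma inv_modulus_id: "inv_modulus (\<lambda>x::'a::euclidean_space. x) = 1"
  using nn_integral_lborel_linear[of "\<lambda>x::'a. x" "indicator (box 0 One)"]
  by (simp add: linear_iff nn_integral_unit_box del: nn_integral_indicator)

lemma inv_modulus_compose:
  fixes S T :: "'a::euclidean_space \<Rightarrow> 'a"
  assumes "linear S" "linear T" "inj T"
  shows "inv_modulus (\<lambda>x. S (T x)) = inv_modulus S * inv_modulus T"
proof -
  note [measurable] = borel_measurable_linear[OF assms(1)]
  show ?thesis
    unfolding inv_modulus_def[of "\<lambda>x. S (T x)"]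
    by (subst nn_integral_lborel_linear[OF assms(2,3), of "\<lambda>x. indicator (box 0 One) (- S x)"])
       (simp_all add: inv_modulus_def[of S] mult.commute)
qed

text \<open>The unit ball is its own preimage and has positive finite volume, so the scaling factor
  can only be one.\<close>

lemma inv_modulus_isometry:
  fixes T :: "'a::euclidean_space \<Rightarrow> 'a"
  assumes "linear T" and iso: "\<And>x. norm (T x) = norm x"
  shows "inv_modulus T = 1"
proof -
  have "inj T"
    using iso by (subst linear_injective_0[OF assms(1)]) (metis norm_eq_zero)
  let ?b = "ball (0::'a) 1"
  have "emeasure lborel ?b = (\<integral>\<^sup>+x. indicator ?b (T x) \<partial>lborel)"
    by (subst nn_integral_indicator[symmetric])
       (auto intro!: nn_integral_cong simp del: nn_integral_indicator simp: indicator_def iso)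
  also have "\<dots> = inv_modulus T * emeasure lborel ?b"
    by (subst nn_integral_lborel_linear[OF assms(1) \<open>inj T\<close>, of "indicator ?b"])
       (auto intro!: borel_measurable_indicator)
  finally have *: "emeasure lborel ?b = inv_modulus T * emeasure lborel ?b" .
  have "measure lborel ?b > 0"
    using content_ball_pos[of 1 "0::'a"] by (simp add: measure_completion)
  then have "emeasure lborel ?b \<noteq> 0" "emeasure lborel ?b \<noteq> \<infinity>"
    by (auto simp: measure_def emeasure_lborel_ball_finite)
  with * show ?thesis
    using ennreal_mult_cancel_left[of "emeasure lborel ?b" 1 "inv_modulus T"]
    by (auto simp: mult.commute)
qed

text \<open>Serves the coordinate transpositions below: being involutions, they have a modulus with
  square one.\<close>

lemma ennreal_square_eq_1:
  assumes "x * x = (1 :: ennreal)"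
  shows "x = 1"
proof (rule antisym)
  show "x \<le> 1"
  proof (rule ccontr)
    assume *: "\<not> x \<le> 1"
    then have "x * 1 \<le> x * x" by (intro mult_left_mono) auto
    with * assms show False by simp
  qed
  show "1 \<le> x"
  proof (rule ccontr)
    assume *: "\<not> 1 \<le> x"
    then have "x * x \<le> x * 1" by (intro mult_left_mono) auto
    with * assms show False by simp
  qed
qed

text \<open>The quantity to be shown equal to 1 for injective maps. It is multiplicative under
  composition, so elementary maps suffice.\<close>

definition det_modulus :: "(real^'k \<Rightarrow> real^'k) \<Rightarrow> ennreal" where
  "det_modulus T = inv_modulus T * ennreal \<bar>det (matrix T)\<bar>"

lemma det_modulus_compose:
  fixes S T :: "real^'k \<Rightarrow> real^'k"
  assumes "linear S" "linear T" "inj T"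
  shows "det_modulus (\<lambda>x. S (T x)) = det_modulus S * det_modulus T"
  using matrix_compose[OF assms(2,1)]
  by (simp add: det_modulus_def inv_modulus_compose[OF assms] o_def det_mul abs_mult ennreal_mult mult_ac)

lemma det_modulus_id: "det_modulus (\<lambda>x. x) = 1"
  by (simp add: det_modulus_def inv_modulus_id matrix_id_mat_1[unfolded id_def])

lemma det_modulus_diagonal:
  fixes c :: "'k::finite \<Rightarrow> real"
  assumes c: "\<And>i. c i \<noteq> 0"
  shows "det_modulus (\<lambda>x::real^'k. \<chi> i. c i * x $ i) = 1"
proof -
  let ?T = "\<lambda>x::real^'k. \<chi> i. c i * x $ i"
  have lin: "linear ?T" by (auto simp: linear_iff vec_eq_iff algebra_simps)
  note [measurable] = borel_measurable_linear[OF lin]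
  have inj: "inj ?T" using c by (auto simp: inj_def vec_eq_iff)
  \<comment> \<open>\<open>lborel_affine_euclidean\<close> wants coefficients indexed by basis
    vectors; \<open>c'\<close> recovers \<open>c i\<close> from \<open>axis i 1\<close>.\<close>
  define c' where "c' b = (\<Sum>i\<in>UNIV. c i * b $ i)" for b :: "real^'k"
  have c'_axis: "c' (axis i 1) = c i" for i
    by (simp add: c'_def axis_def if_distrib cong: if_cong)
  have c'_nz: "c' j \<noteq> 0" if "j \<in> Basis" for j
    using that c c'_axis by (auto simp: Basis_vec_def)
  have T: "0 + (\<Sum>j\<in>Basis. (c' j * (x \<bullet> j)) *\<^sub>R j) = ?T x" for x
  proof (rule vec_eq_iff[THEN iffD2], rule)
    fix i
    have Bas: "(Basis :: (real^'k) set) = range (\<lambda>i. axis i 1)"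
      by (auto simp: Basis_vec_def)
    have injax: "inj (\<lambda>i::'k. axis i (1::real))" by (auto simp: inj_def axis_eq_axis)
    show "(0 + (\<Sum>j\<in>Basis. (c' j * (x \<bullet> j)) *\<^sub>R j)) $ i = ?T x $ i"
      unfolding Bas
      by (simp add: sum.reindex[OF injax] c'_axis inner_axis)
         (simp add: axis_def if_distrib cong: if_cong)
  qed
  have prod: "(\<Prod>j\<in>(Basis::(real^'k) set). \<bar>c' j\<bar>) = (\<Prod>i\<in>UNIV. \<bar>c i\<bar>)"
  proof -
    have Bas: "(Basis :: (real^'k) set) = range (\<lambda>i. axis i 1)"
      by (auto simp: Basis_vec_def)
    have injax: "inj (\<lambda>i::'k. axis i (1::real))" by (auto simp: inj_def axis_eq_axis)
    show ?thesis unfolding Bas by (simp add: prod.reindex[OF injax] c'_axis)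
  qed
  have leb: "lborel = density (distr lborel borel ?T) (\<lambda>_. ennreal (\<Prod>i\<in>UNIV. \<bar>c i\<bar>))"
    using lborel_affine_euclidean[of c' 0, OF c'_nz] unfolding T prod by simp
  let ?B = "indicator (box 0 One) :: real^'k \<Rightarrow> ennreal"
  have "1 = (\<integral>\<^sup>+x. ?B x \<partial>lborel)" by (simp only: nn_integral_unit_box)
  also have "\<dots> = (\<integral>\<^sup>+x. ennreal (\<Prod>i\<in>UNIV. \<bar>c i\<bar>) * ?B (?T x) \<partial>lborel)"
    by (subst leb, subst nn_integral_density) (simp_all add: nn_integral_distr)
  also have "\<dots> = ennreal (\<Prod>i\<in>UNIV. \<bar>c i\<bar>) * (\<integral>\<^sup>+x. ?B (?T x) \<partial>lborel)"
    by (rule nn_integral_cmult) simp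
  also have "(\<integral>\<^sup>+x. ?B (?T x) \<partial>lborel) = inv_modulus ?T"
    by (subst nn_integral_lborel_linear[OF lin inj]) (simp_all add: emeasure_lborel_box_eq inner_Basis)
  finally have 1: "ennreal (\<Prod>i\<in>UNIV. \<bar>c i\<bar>) * inv_modulus ?T = 1" by simp
  have "det (matrix ?T) = (\<Prod>i\<in>UNIV. c i)"
    by (subst det_diagonal) (simp_all add: matrix_def axis_def)
  with 1 show ?thesis
    by (simp add: det_modulus_def abs_prod mult.commute)
qed

theorem inv_modulus_det:
  fixes T :: "real^'k \<Rightarrow> real^'k"
  assumes "linear T" "inj T"
  shows "inv_modulus T * ennreal \<bar>det (matrix T)\<bar> = 1"
proof -
  \<comment> \<open>Singular elementary maps take part in the induction, hence the premise
    \<open>inj T\<close>. In a composition on a finite-dimensional space it passes to both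
    factors.\<close>
  have "linear T \<and> (inj T \<longrightarrow> det_modulus T = 1)"
  proof (rule induct_linear_elementary[OF assms(1)])
    fix f g :: "real^'k \<Rightarrow> real^'k"
    assume fg: "linear f" "linear g" "linear f \<and> (inj f \<longrightarrow> det_modulus f = 1)"
       "linear g \<and> (inj g \<longrightarrow> det_modulus g = 1)"
    have "det_modulus (f \<circ> g) = 1" if "inj (f \<circ> g)"
    proof -
      have g: "inj g" using that inj_on_imageI2 by blast
      then have "surj g" using fg(2) linear_injective_imp_surjective by blast
      then have f: "inj f" using that
        by (metis comp_apply injD injI surjD)
      show ?thesis
        using det_modulus_compose[OF fg(1,2) g] fg f g by (simp add: o_def)
    qed
    then show "linear (f \<circ> g) \<and> (inj (f \<circ> g) \<longrightarrow> det_modulus (f \<circ> g) = 1)"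
      using fg linear_compose by blast
  next
    fix f :: "real^'k \<Rightarrow> real^'k" and i
    assume f: "linear f" "\<And>x. f x $ i = 0"
    have "\<not> inj f"
    proof
      assume "inj f"
      then have "surj f" using f(1) linear_injective_imp_surjective by blast
      then obtain x where "f x = axis i 1" by (metis surjD)
      with f(2)[of x] show False by (simp add: axis_def)
    qed
    with f show "linear f \<and> (inj f \<longrightarrow> det_modulus f = 1)" by blast
  next
    fix c :: "'k \<Rightarrow> real"
    let ?T = "\<lambda>x::real^'k. \<chi> i. c i * x $ i"
    have "linear ?T" by (auto simp: linear_iff vec_eq_iff algebra_simps)
    moreover have "c i \<noteq> 0" if "inj ?T" for i
    proof
      assume "c i = 0"
      then have "?T (axis i 1) = ?T 0" by (simp add: vec_eq_iff axis_def)
      with that have "axis i (1::real) = 0" by (rule injD)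
      then show False by simp
    qed
    ultimately show "linear ?T \<and> (inj ?T \<longrightarrow> det_modulus ?T = 1)"
      using det_modulus_diagonal by blast
  next
    fix m n :: 'k
    let ?T = "\<lambda>x::real^'k. \<chi> i. x $ Transposition.transpose m n i"
    have lin: "linear ?T" by (auto simp: linear_iff vec_eq_iff)
    have TT: "?T (?T x) = x" for x by (simp add: vec_eq_iff)
    have "inj ?T" by (rule inj_on_inverseI[of _ ?T]) (rule TT)
    have "det_modulus ?T * det_modulus ?T = 1"
      using det_modulus_compose[OF lin lin \<open>inj ?T\<close>] by (simp only: TT det_modulus_id)
    then have "det_modulus ?T = 1"
      by (rule ennreal_square_eq_1)
    with lin show "linear ?T \<and> (inj ?T \<longrightarrow> det_modulus ?T = 1)" by blast
  next
    fix m n :: 'k assume "m \<noteq> n"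
    let ?T = "\<lambda>x::real^'k. \<chi> i. if i = m then x $ m + x $ n else x $ i"
    let ?T' = "\<lambda>x::real^'k. \<chi> i. if i = m then x $ m - x $ n else x $ i"
    \<comment> \<open>Halving coordinate n conjugates the shear into its square: D T = T T D. As D
      has modulus 1, the modulus of T equals its own square, and the inverse shear
      \<open>?T'\<close> excludes the values 0 and infinity.\<close>
    let ?D = "\<lambda>x::real^'k. \<chi> i. (if i = n then 1/2 else 1) * x $ i"
    have lin: "linear ?T" "linear ?T'" "linear ?D" 
      by (auto simp: linear_iff vec_eq_iff algebra_simps)
    have T'T: "?T' (?T x) = x" for x using \<open>m \<noteq> n\<close> by (simp add: vec_eq_iff)
    have inj: "inj ?T" by (rule inj_on_inverseI[of _ ?T']) (rule T'T)
    have injD: "inj ?D" by (auto simp: inj_def vec_eq_iff split: if_splits)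
    have D1: "det_modulus ?D = 1" by (rule det_modulus_diagonal) simp
    have "linear (\<lambda>x. ?T (?T x))" using linear_compose[OF lin(1,1)] by (simp only: o_def)
    have "det_modulus (\<lambda>x. ?D (?T x)) = det_modulus (\<lambda>x. ?T (?T (?D x)))"
      using \<open>m \<noteq> n\<close> by (intro arg_cong[of _ _ det_modulus]) (auto simp: vec_eq_iff)
    then have 1: "det_modulus ?T = det_modulus ?T * det_modulus ?T"
      using det_modulus_compose[OF lin(3,1) inj] 
       det_modulus_compose[OF \<open>linear (\<lambda>x. ?T (?T x))\<close> lin(3) injD] 
       det_modulus_compose[OF lin(1,1) inj]
      by (simp only: D1 mult_1_right mult_1_left)
    have "det_modulus ?T' * det_modulus ?T = 1"
      using det_modulus_compose[OF lin(2,1) inj] by (simp only: T'T det_modulus_id)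
    then have "det_modulus ?T = 1"
      using 1 mult.assoc[of "det_modulus ?T'" "det_modulus ?T" "det_modulus ?T"] by simp
    with lin show "linear ?T \<and> (inj ?T \<longrightarrow> det_modulus ?T = 1)" by blast
  qed
  with assms show ?thesis by (simp add: det_modulus_def)
qed

subsection \<open>Symmetric square roots\<close>

lemma dot_matrix_vector:
  fixes A :: "real^'k^'k"
  shows "v \<bullet> (A *v w) = (transpose A *v v) \<bullet> w"
  by (metis dot_lmul_matrix vector_transpose_matrix transpose_transpose)

text \<open>Brings positivity of a quadratic form into trace identities: the summands are values of
  the form of R at the columns of D.\<close>

lemma trace_quadratic:
  fixes D R :: "real^'k^'k"
  assumes "transpose D = D"
  shows "trace (D ** R ** D) = (\<Sum>i\<in>UNIV. (D *v axis i 1) \<bullet> (R *v (D *v axis i 1)))"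
proof -
  have "(D ** R ** D) $ i $ i = (D *v axis i 1) \<bullet> (R *v (D *v axis i 1))" for i
  proof -
    have "(D *v axis i 1) \<bullet> (R *v (D *v axis i 1)) = axis i 1 \<bullet> (D *v (R *v (D *v axis i 1)))"
      using dot_matrix_vector[of "axis i 1" D] by (simp add: assms inner_commute)
    also have "\<dots> = axis i 1 \<bullet> ((D ** R ** D) *v axis i 1)"
      by (simp add: matrix_vector_mul_assoc matrix_mul_assoc)
    also have "\<dots> = (D ** R ** D) $ i $ i"
      by (simp add: inner_axis' matrix_vector_mult_basis column_def)
    finally show ?thesis by simp
  qed
  then show ?thesis by (simp add: trace_def)
qed

text \<open>With \<open>D = R - Q\<close> one has \<open>R D + D Q = 0\<close>; multiply by \<open>D\<close> and take traces.\<close>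

lemma symmetric_sqrt_unique:
  fixes R Q :: "real^'k^'k"
  assumes R: "transpose R = R" "\<And>v. v \<noteq> 0 \<Longrightarrow> 0 < v \<bullet> (R *v v)"
    and Q: "transpose Q = Q" "\<And>v. 0 \<le> v \<bullet> (Q *v v)"
    and eq: "R ** R = Q ** Q"
  shows "Q = R"
proof -
  define D where "D = R - Q"
  have D: "transpose D = D" using R(1) Q(1) by (simp add: D_def transpose_def vec_eq_iff)
  have "R ** D + D ** Q = 0"
  proof (rule matrix_eq[THEN iffD2], rule)
    fix x
    have "R *v (R *v x) = Q *v (Q *v x)"
      using eq by (simp add: matrix_vector_mul_assoc)
    then show "(R ** D + D ** Q) *v x = 0 *v x"
      by (simp add: D_def matrix_vector_mul_assoc[symmetric] algebra_simps)
  qed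
  then have "0 = trace (D ** (R ** D + D ** Q))"
    by (simp add: matrix_matrix_mult_def trace_def)
  also have "\<dots> = trace (D ** R ** D) + trace (D ** (D ** Q))"
    by (simp add: matrix_add_ldistrib trace_add matrix_mul_assoc)
  also have "trace (D ** (D ** Q)) = trace (D ** Q ** D)"
    by (metis trace_mul_sym)
  finally have 0: "trace (D ** R ** D) + trace (D ** Q ** D) = 0" by simp
  \<comment> \<open>Two nonnegative traces with sum zero both vanish, and strict positivity of R
    then kills every column of D. Thus Q may be merely semidefinite, as in the description defining
    \<open>sym_sqrt\<close>.\<close>
  have "trace (D ** Q ** D) \<ge> 0" unfolding trace_quadratic[OF D] by (intro sum_nonneg Q(2))
  moreover have Rn: "0 \<le> v \<bullet> (R *v v)" for v using R(2)[of v] by (cases "v = 0") auto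
  ultimately have "trace (D ** R ** D) \<le> 0" "(\<Sum>i\<in>UNIV. (D *v axis i 1) \<bullet> (R *v (D *v axis i 1))) \<ge> 0"
    using 0 by (auto intro!: sum_nonneg)
  then have "(\<Sum>i\<in>UNIV. (D *v axis i 1) \<bullet> (R *v (D *v axis i 1))) = 0"
    unfolding trace_quadratic[OF D] by linarith
  then have "(D *v axis i 1) \<bullet> (R *v (D *v axis i 1)) = 0" for i
    using Rn by (subst (asm) sum_nonneg_eq_0_iff) auto
  then have "D *v axis i 1 = 0" for i
    using R(2) by (metis less_irrefl)
  then have "D = 0"
    by (simp add: matrix_vector_mult_basis column_def vec_eq_iff)
  then show ?thesis by (simp add: D_def)
qed

text \<open>For \<open>A = 1 - S / c\<close> of norm below one, the fixed point of \<open>Y \<mapsto> (A + Y\<^sup>2) / 2\<close>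
  satisfies \<open>(1 - Y)\<^sup>2 = 1 - A\<close>.\<close>

lemma contraction_sqrt_exists:
  fixes A :: "'a::euclidean_space \<Rightarrow>\<^sub>L 'a"
  assumes "norm A < 1" and sym: "\<And>v w. A v \<bullet> w = v \<bullet> A w"
  shows "\<exists>Y. norm (Y :: 'a \<Rightarrow>\<^sub>L 'a) < 1 \<and> (\<forall>v w. Y v \<bullet> w = v \<bullet> Y w) \<and> (\<forall>v. A v + Y (Y v) = 2 *\<^sub>R Y v)"
proof -
  define q where "q = norm A"
  have q: "0 \<le> q" "q < 1" using assms by (auto simp: q_def)
  \<comment> \<open>F preserves the radius because (q + q^2) / 2 \<le> q. Self-adjointness is part
    of the complete set, so the fixed point inherits it.\<close>
  define S where "S = {Y. norm (Y :: 'a \<Rightarrow>\<^sub>L 'a) \<le> q \<and> (\<forall>v w. Y v \<bullet> w = v \<bullet> Y w)}"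
  define F where "F Y = (1/2::real) *\<^sub>R (A + (Y o\<^sub>L Y))" for Y :: "'a \<Rightarrow>\<^sub>L 'a"
  have "closed {Y. (Y :: 'a \<Rightarrow>\<^sub>L 'a) v \<bullet> w = v \<bullet> Y w}" for v w
    by (intro closed_Collect_eq continuous_intros)
  then have "closed (cball 0 q \<inter> (\<Inter>v. \<Inter>w. {Y. (Y :: 'a \<Rightarrow>\<^sub>L 'a) v \<bullet> w = v \<bullet> Y w}))"
    by (intro closed_Int closed_INT) auto
  also have "cball 0 q \<inter> (\<Inter>v. \<Inter>w. {Y. (Y :: 'a \<Rightarrow>\<^sub>L 'a) v \<bullet> w = v \<bullet> Y w}) = S"
    by (auto simp: S_def)
  finally have "closed S" .
  note complete_eq_closed[THEN iffD2, OF this]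
  moreover have "S \<noteq> {}" using q by (auto simp: S_def intro!: exI[of _ 0])
  moreover have "F ` S \<subseteq> S"
  proof
    fix Z assume "Z \<in> F ` S"
    then obtain Y where Y: "Y \<in> S" "Z = F Y" by blast
    have nY: "norm Y \<le> q" using Y by (simp add: S_def)
    have "norm (Y o\<^sub>L Y) \<le> norm Y * norm Y" by (rule norm_blinfun_compose)
    also have "\<dots> \<le> q * 1" using nY q by (intro mult_mono) auto
    finally have "norm (A + (Y o\<^sub>L Y)) \<le> q + q"
      using norm_triangle_ineq[of A "Y o\<^sub>L Y"] by (simp add: q_def)
    then have "norm Z \<le> q" by (simp add: Y F_def)
    moreover have "Z v \<bullet> w = v \<bullet> Z w" for v w
      using Y(1) sym by (simp add: Y(2) F_def S_def blinfun.bilinear_simps inner_simps)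
    ultimately show "Z \<in> S" by (simp add: S_def)
  qed
  moreover have "dist (F X) (F Y) \<le> q * dist X Y" if "X \<in> S \<and> Y \<in> S" for X Y
  proof -
    \<comment> \<open>X and Y need not commute; this form of the difference of squares still has X -
      Y in each term, and radius q gives the contraction factor q.\<close>
    have "(X o\<^sub>L X) - (Y o\<^sub>L Y) = (X o\<^sub>L (X - Y)) + ((X - Y) o\<^sub>L Y)"
      by (rule blinfun_eqI) (simp add: blinfun.bilinear_simps)
    then have "norm ((X o\<^sub>L X) - (Y o\<^sub>L Y)) \<le> norm X * norm (X - Y) + norm (X - Y) * norm Y"
      by (metis norm_triangle_mono norm_blinfun_compose)
    also have "\<dots> \<le> q * norm (X - Y) + norm (X - Y) * q"
      using that by (intro add_mono mult_mono) (use q in \<open>auto simp: S_def\<close>)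
    finally have "norm ((X o\<^sub>L X) - (Y o\<^sub>L Y)) \<le> 2 * (q * norm (X - Y))" by simp
    moreover have "F X - F Y = (1/2::real) *\<^sub>R ((X o\<^sub>L X) - (Y o\<^sub>L Y))"
      by (simp add: F_def algebra_simps)
    ultimately show ?thesis by (simp add: dist_norm)
  qed
  ultimately have "\<exists>!Y. Y \<in> S \<and> F Y = Y"
    using q by (intro Banach_fix) auto
  then obtain Y where Y: "Y \<in> S" "F Y = Y" by blast
  have "A v + Y (Y v) = 2 *\<^sub>R Y v" for v
  proof -
    have "2 *\<^sub>R Y v = 2 *\<^sub>R (F Y) v" using Y by simp
    then show ?thesis by (simp add: F_def blinfun.bilinear_simps)
  qed
  then show ?thesis using Y q by (intro exI[of _ Y]) (auto simp: S_def)
qed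

text \<open>For large c the operator A = 1 - S / c has norm below one. With the fixed point Y for A,
  (1 - Y)^2 = 1 - A = S / c, so sqrt c (1 - Y) is a root; it is positive because Y has norm below
  one.\<close>

lemma symmetric_sqrt_exists:
  fixes S :: "real^'k^'k"
  assumes "sym_pos_def S"
  shows "\<exists>R. transpose R = R \<and> (\<forall>v. v \<noteq> 0 \<longrightarrow> 0 < v \<bullet> (R *v v)) \<and> R ** R = S"
proof -
  have St: "transpose S = S" and Sp: "\<And>v. v \<noteq> 0 \<Longrightarrow> 0 < v \<bullet> (S *v v)"
    using assms by (auto simp: sym_pos_def_def)
  have blS: "bounded_linear ((*v) S)" by (rule matrix_vector_mul_bounded_linear)
  have Ssym: "(S *v v) \<bullet> w = v \<bullet> (S *v w)" for v w by (metis dot_matrix_vector St)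
  obtain M where M: "M > 0" "\<And>v. norm (S *v v) \<le> norm v * M"
    using bounded_linear.pos_bounded[OF blS] by blast
  obtain m where m: "m > 0" "\<And>v. m * (norm v)\<^sup>2 \<le> v \<bullet> (S *v v)"
  proof -
    have "compact (sphere (0::real^'k) 1)" "sphere (0::real^'k) 1 \<noteq> {}" by auto
    moreover have "continuous_on (sphere 0 1) (\<lambda>v. v \<bullet> (S *v v))"
      by (intro continuous_intros linear_continuous_on blS)
    ultimately obtain u where u: "u \<in> sphere 0 1" "\<And>v. v \<in> sphere 0 1 \<Longrightarrow> u \<bullet> (S *v u) \<le> v \<bullet> (S *v v)"
      using continuous_attains_inf[of "sphere 0 1" "\<lambda>v. v \<bullet> (S *v v)"] by blast
    have "u \<bullet> (S *v u) * (norm v)\<^sup>2 \<le> v \<bullet> (S *v v)" for v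
    proof (cases "v = 0")
      case False
      have "u \<bullet> (S *v u) \<le> (v /\<^sub>R norm v) \<bullet> (S *v (v /\<^sub>R norm v))"
        using False by (intro u(2)) simp
      also have "\<dots> = (v \<bullet> (S *v v)) / (norm v)\<^sup>2"
        by (simp add: matrix_vector_mult_scaleR power2_eq_square divide_simps)
      finally show ?thesis using False by (simp add: field_simps)
    qed simp
    moreover have "u \<bullet> (S *v u) > 0" using u(1) by (intro Sp) auto
    ultimately show ?thesis using that by blast
  qed
  text \<open>\<open>\<parallel>v - S v / c\<parallel>\<^sup>2 = \<parallel>v\<parallel>\<^sup>2 - 2 (v \<bullet> S v) / c + \<parallel>S v\<parallel>\<^sup>2 / c\<^sup>2\<close>, which contracts for large \<open>c\<close>.\<close>
  define c where "c = M\<^sup>2 / m + m"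
  have c: "c > 0" using M m by (simp add: c_def add_nonneg_pos)
  \<comment> \<open>c \<ge> M^2 / m bounds the quadratic term of the expansion by m / c times the
    squared norm, which leaves the factor 1 - m / c. The summand m in c ensures m / c \<le>
    1.\<close>
  define r where "r = sqrt (1 - m / c)"
  have mc: "m / c \<le> 1" "m / c > 0" using M m c by (auto simp: c_def divide_simps)
  then have r: "0 \<le> r" "r < 1" by (auto simp: r_def)
  define A where "A = Blinfun (\<lambda>v. v - (1/c) *\<^sub>R (S *v v))"
  have A: "A v = v - (1/c) *\<^sub>R (S *v v)" for v
    unfolding A_def by (subst bounded_linear_Blinfun_apply) (intro bounded_linear_intros blS bounded_linear_const_scaleR, rule refl)
  have "norm (A v) \<le> r * norm v" for v
  proof (rule power2_le_imp_le)
    have "(norm (A v))\<^sup>2 = (norm v)\<^sup>2 - 2 / c * (v \<bullet> (S *v v)) + (norm (S *v v))\<^sup>2 / c\<^sup>2"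
      by (simp only: A power2_norm_eq_inner inner_diff_left inner_diff_right inner_scaleR_left
          inner_scaleR_right) (simp add: inner_commute[of "S *v v" v] power2_eq_square divide_simps algebra_simps)
    moreover have "(norm (S *v v))\<^sup>2 / c\<^sup>2 \<le> (norm v * M)\<^sup>2 / c\<^sup>2"
      by (intro divide_right_mono power_mono M(2)) simp_all
    moreover have "2 * (m / c * (norm v)\<^sup>2) \<le> 2 / c * (v \<bullet> (S *v v))"
      using mult_left_mono[OF m(2)[of v], of "2 / c"] c by simp
    moreover have "(norm v * M)\<^sup>2 / c\<^sup>2 \<le> m / c * (norm v)\<^sup>2"
    proof -
      have "M\<^sup>2 \<le> m * c" using m by (simp add: c_def field_simps)
      then have "M\<^sup>2 / c\<^sup>2 \<le> m / c" using c by (simp add: field_simps power2_eq_square)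
      then have "M\<^sup>2 / c\<^sup>2 * (norm v)\<^sup>2 \<le> m / c * (norm v)\<^sup>2" by (rule mult_right_mono) simp
      then show ?thesis by (simp add: power_mult_distrib mult.commute)
    qed
    ultimately have "(norm (A v))\<^sup>2 \<le> (norm v)\<^sup>2 - m / c * (norm v)\<^sup>2"
      by linarith
    also have "\<dots> = (1 - m / c) * (norm v)\<^sup>2" by (simp add: left_diff_distrib)
    also have "1 - m / c = r\<^sup>2" using mc by (simp add: r_def)
    finally show "(norm (A v))\<^sup>2 \<le> (r * norm v)\<^sup>2" by (simp add: power_mult_distrib)
  qed (use r in simp)
  then have "norm A \<le> r" using r by (intro norm_blinfun_bound) auto
  then have "norm A < 1" using r by simp
  moreover have "A v \<bullet> w = v \<bullet> A w" for v w
    by (simp add: A inner_simps Ssym)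
  ultimately obtain Y :: "(real^'k) \<Rightarrow>\<^sub>L (real^'k)" where Y: "norm Y < 1" "\<And>v w. Y v \<bullet> w = v \<bullet> Y w" 
      "\<And>v. A v + Y (Y v) = 2 *\<^sub>R Y v"
    using contraction_sqrt_exists by metis
  define R where "R = matrix (\<lambda>v. sqrt c *\<^sub>R (v - Y v))"
  have lin: "linear (\<lambda>v. sqrt c *\<^sub>R (v - Y v))"
    by (auto simp: linear_iff blinfun.bilinear_simps algebra_simps)
  have R: "R *v v = sqrt c *\<^sub>R (v - Y v)" for v
    unfolding R_def by (rule matrix_works) (simp only: linear_matrix_vector_mul_eq lin)
  have "(R ** R) *v v = S *v v" for v
  proof -
    have "(R ** R) *v v = c *\<^sub>R (v - 2 *\<^sub>R Y v + Y (Y v))"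
      using c by (simp add: matrix_vector_mul_assoc[symmetric] R blinfun.bilinear_simps algebra_simps scaleR_2)
    also have "v - 2 *\<^sub>R Y v + Y (Y v) = v - A v" 
      by (simp add: Y(3)[of v, symmetric])
    finally show ?thesis using c by (simp add: A)
  qed
  then have "R ** R = S" by (simp add: matrix_eq)
  moreover have "transpose R = R"
  proof -
    have "(R *v v) \<bullet> w = v \<bullet> (R *v w)" for v w using Y(2) by (simp add: R inner_simps)
    then have "transpose R *v w = R *v w" for w
      using dot_matrix_vector[of _ R w] dot_matrix_vector[of _ "transpose R" w]
      by (intro vector_eq_ldot[THEN iffD1]) (simp add: transpose_transpose)
    then show ?thesis by (simp add: matrix_eq)
  qed
  moreover have "0 < v \<bullet> (R *v v)" if "v \<noteq> 0" for v
  proof -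
    have "v \<bullet> Y v \<le> norm v * norm (Y v)" by (rule norm_cauchy_schwarz)
    also have "\<dots> \<le> norm v * (norm Y * norm v)" by (intro mult_left_mono norm_blinfun) auto
    also have "\<dots> < v \<bullet> v" using that Y(1) by (simp add: dot_square_norm power2_eq_square)
    finally show ?thesis using c by (simp add: R inner_simps)
  qed
  ultimately show ?thesis by blast
qed

lemma sym_sqrt_works:
  assumes "sym_pos_def S"
  shows "transpose (sym_sqrt S) = sym_sqrt S" "sym_sqrt S ** sym_sqrt S = S"
    "sym_pos_def (sym_sqrt S)"
proof -
  obtain R where R: "transpose R = R" "\<And>v. v \<noteq> 0 \<Longrightarrow> 0 < v \<bullet> (R *v v)" "R ** R = S"
    using symmetric_sqrt_exists[OF assms] by blast
  have "sym_sqrt S = R"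
    unfolding sym_sqrt_def
  proof (rule the_equality)
    have "0 \<le> v \<bullet> (R *v v)" for v using R(2)[of v] by (cases "v = 0") auto
    then show "transpose R = R \<and> (\<forall>v. 0 \<le> v \<bullet> (R *v v)) \<and> R ** R = S"
      using R by simp
  next
    fix Q assume Q: "transpose Q = Q \<and> (\<forall>v. 0 \<le> v \<bullet> (Q *v v)) \<and> Q ** Q = S"
    show "Q = R"
      by (rule symmetric_sqrt_unique[OF R(1,2)]) (use Q R(3) in auto)
  qed
  with R show "transpose (sym_sqrt S) = sym_sqrt S" "sym_sqrt S ** sym_sqrt S = S"
    "sym_pos_def (sym_sqrt S)" by (auto simp: sym_pos_def_def)
qed

subsection \<open>Centred Gaussian laws\<close>

lemma nn_integral_exp_neg_sq:
  assumes "\<sigma> > 0"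
  shows "(\<integral>\<^sup>+x. ennreal (exp (- x\<^sup>2 / (2 * \<sigma>\<^sup>2))) \<partial>lborel) = ennreal (sqrt (2 * pi * \<sigma>\<^sup>2))"
proof -
  interpret prob_space "density lborel (normal_density 0 \<sigma>)"
    by (rule prob_space_normal_density) (fact assms)
  have pos: "sqrt (2 * pi * \<sigma>\<^sup>2) > 0" using assms by simp
  have "(\<integral>\<^sup>+x. ennreal (exp (- x\<^sup>2 / (2 * \<sigma>\<^sup>2))) \<partial>lborel) =
      (\<integral>\<^sup>+x. ennreal (sqrt (2 * pi * \<sigma>\<^sup>2)) * ennreal (normal_density 0 \<sigma> x) \<partial>lborel)"
    using pos assms by (intro nn_integral_cong) (simp add: normal_density_def ennreal_mult[symmetric])
  also have "\<dots> = ennreal (sqrt (2 * pi * \<sigma>\<^sup>2)) * emeasure (density lborel (normal_density 0 \<sigma>)) UNIV"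
    by (simp add: nn_integral_cmult emeasure_density)
  also have "emeasure (density lborel (normal_density 0 \<sigma>)) UNIV = 1"
    using emeasure_space_1 by simp
  finally show ?thesis by simp
qed

text \<open>Two values of \<sigma> occur: 1 normalises the standard density, and sqrt 2 gives the
  wider Gaussian that dominates the moments.\<close>

lemma nn_integral_exp_neg_norm_sq:
  assumes "\<sigma> > 0"
  shows "(\<integral>\<^sup>+x. ennreal (exp (- (x \<bullet> x) / (2 * \<sigma>\<^sup>2))) \<partial>(lborel :: 'a::euclidean_space measure)) =
    ennreal (sqrt (2 * pi * \<sigma>\<^sup>2) ^ DIM('a))"
proof -
  have "exp (- (x \<bullet> x) / (2 * \<sigma>\<^sup>2)) = (\<Prod>b\<in>Basis. exp (- (x \<bullet> b)\<^sup>2 / (2 * \<sigma>\<^sup>2)))" for x :: 'a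
    by (subst euclidean_inner)
       (simp add: exp_sum[symmetric] sum_negf sum_divide_distrib power2_eq_square)
  then have "(\<integral>\<^sup>+x. ennreal (exp (- (x \<bullet> x) / (2 * \<sigma>\<^sup>2))) \<partial>(lborel :: 'a measure)) =
     (\<integral>\<^sup>+x. (\<Prod>b\<in>Basis. ennreal (exp (- (x \<bullet> b)\<^sup>2 / (2 * \<sigma>\<^sup>2)))) \<partial>(lborel :: 'a measure))"
    by (simp add: prod_ennreal)
  also have "\<dots> = (\<Prod>b\<in>(Basis::'a set). \<integral>\<^sup>+x. ennreal (exp (- x\<^sup>2 / (2 * \<sigma>\<^sup>2))) \<partial>lborel)"
    by (rule nn_integral_lborel_prod) auto
  also have "\<dots> = ennreal (sqrt (2 * pi * \<sigma>\<^sup>2) ^ DIM('a))"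
    by (subst nn_integral_exp_neg_sq[OF assms]) (simp add: ennreal_power)
  finally show ?thesis .
qed

text \<open>Defined on every Euclidean space, so that a pair of independent standard Gaussians is
  one standard Gaussian on the product type and can be rotated there.\<close>

definition std_gauss_density :: "'a::euclidean_space \<Rightarrow> real" where
  "std_gauss_density x = exp (- (x \<bullet> x) / 2) / sqrt ((2 * pi) ^ DIM('a))"

definition std_gauss :: "'a::euclidean_space measure" where
  "std_gauss = density lborel (\<lambda>x. ennreal (std_gauss_density x))"

lemma std_gauss_density_nonneg: "0 \<le> std_gauss_density x"
  by (simp add: std_gauss_density_def)

lemma borel_measurable_std_gauss_density [measurable]: "std_gauss_density \<in> borel_measurable borel"
  unfolding std_gauss_density_def by measurable

lemma sets_std_gauss [simp, measurable_cong]: "sets std_gauss = sets borel"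
  by (simp add: std_gauss_def)

lemma space_std_gauss [simp]: "space std_gauss = UNIV"
  by (simp add: std_gauss_def)

lemma measurable_std_gauss [simp]: "measurable std_gauss N = measurable borel N"
  by (rule measurable_cong_sets) auto

lemma prob_space_std_gauss: "prob_space (std_gauss :: 'a::euclidean_space measure)"
proof
  let ?K = "sqrt ((2 * pi) ^ DIM('a))"
  have K: "?K > 0" by simp
  have "emeasure (std_gauss :: 'a measure) (space std_gauss) =
      (\<integral>\<^sup>+x. ennreal (1 / ?K) * ennreal (exp (- (x \<bullet> x) / (2 * 1\<^sup>2))) \<partial>(lborel :: 'a measure))"
    unfolding std_gauss_def
    by (simp add: emeasure_density)
       (intro nn_integral_cong, simp add: std_gauss_density_def ennreal_mult[symmetric])
  also have "\<dots> = ennreal (1 / ?K) * ennreal (sqrt (2 * pi * 1\<^sup>2) ^ DIM('a))"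
    by (subst nn_integral_cmult) (simp_all only: nn_integral_exp_neg_norm_sq[of 1, OF zero_less_one], measurable)
  also have "\<dots> = 1"
    using K by (simp add: ennreal_mult[symmetric] real_sqrt_power[symmetric] del: real_sqrt_power)
  finally show "emeasure (std_gauss :: 'a measure) (space std_gauss) = 1" .
qed

text \<open>Half of the Gaussian exponent absorbs the polynomial: q |x| \<le> q^2 + |x|^2 / 4, since
  (q - |x| / 2)^2 \<ge> 0. What remains is a Gaussian of variance 2.\<close>

lemma std_gauss_moment:
  "integrable (std_gauss :: 'a::euclidean_space measure) (\<lambda>x. (1 + norm x) ^ q)"
proof -
  let ?K = "sqrt ((2 * pi) ^ DIM('a))"
  have bound: "std_gauss_density x * (1 + norm x) ^ q
      \<le> exp ((real q)\<^sup>2) / ?K * exp (- (x \<bullet> x) / (2 * (sqrt 2)\<^sup>2))" for x :: 'a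
  proof -
    have "(1 + norm x) ^ q \<le> exp (norm x) ^ q" by (intro power_mono) auto
    also have "\<dots> = exp (real q * norm x)" by (simp add: exp_of_nat_mult)
    also have "\<dots> \<le> exp ((real q)\<^sup>2 + (norm x)\<^sup>2 / 4)"
      using zero_le_power2[of "real q - norm x / 2"]
      by (simp add: power2_diff power_divide)
    finally have "exp (- (x \<bullet> x) / 2) * (1 + norm x) ^ q
        \<le> exp (- (x \<bullet> x) / 2) * exp ((real q)\<^sup>2 + (norm x)\<^sup>2 / 4)"
      by (rule mult_left_mono) simp
    also have "\<dots> = exp ((real q)\<^sup>2) * exp (- (x \<bullet> x) / (2 * (sqrt 2)\<^sup>2))"
      by (simp add: exp_add[symmetric] dot_square_norm)
    finally show ?thesis
      by (simp add: std_gauss_density_def divide_right_mono)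
  qed
  have "integrable lborel (\<lambda>x::'a. exp ((real q)\<^sup>2) / ?K * exp (- (x \<bullet> x) / (2 * (sqrt 2)\<^sup>2)))"
  proof (intro integrable_mult_right integrableI_nonneg)
    show "(\<integral>\<^sup>+x. ennreal (exp (- (x \<bullet> x) / (2 * (sqrt 2)\<^sup>2))) \<partial>(lborel :: 'a measure)) < \<infinity>"
      by (subst nn_integral_exp_neg_norm_sq) auto
  qed auto
  then have "integrable lborel (\<lambda>x::'a. std_gauss_density x * (1 + norm x) ^ q)"
    by (rule Bochner_Integration.integrable_bound)
       (use bound in \<open>auto simp: std_gauss_density_nonneg abs_mult intro!: AE_I2\<close>)
  then show ?thesis
    unfolding std_gauss_def
    by (subst integrable_density) (auto simp: std_gauss_density_nonneg)
qed

text \<open>The density depends on the norm only, and an isometry preserves Lebesgue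
  measure.\<close>

lemma distr_std_gauss_isometry:
  fixes T :: "'a::euclidean_space \<Rightarrow> 'a"
  assumes "linear T" and iso: "\<And>x. norm (T x) = norm x"
  shows "distr std_gauss borel T = std_gauss"
proof (rule measure_eqI)
  note [measurable] = borel_measurable_linear[OF assms(1)]
  have "inj T"
    using iso by (subst linear_injective_0[OF assms(1)]) (metis norm_eq_zero)
  have dens: "std_gauss_density (T x) = std_gauss_density x" for x
    by (simp add: std_gauss_density_def dot_square_norm iso)
  fix A assume "A \<in> sets (distr std_gauss borel T)"
  then have [measurable]: "A \<in> sets borel" by simp
  have [simp]: "T -` A \<in> sets borel"
    using measurable_sets[OF borel_measurable_linear[OF assms(1)] \<open>A \<in> sets borel\<close>] by simp
  have "emeasure (distr std_gauss borel T) A =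
      emeasure (density lborel std_gauss_density) (T -` A)"
    by (subst emeasure_distr) (auto simp: std_gauss_def)
  also have "\<dots> = (\<integral>\<^sup>+x. ennreal (std_gauss_density (T x)) * indicator A (T x) \<partial>lborel)"
    by (subst emeasure_density) (auto simp: dens indicator_def intro!: nn_integral_cong)
  also have "\<dots> = (\<integral>\<^sup>+x. ennreal (std_gauss_density x) * indicator A x \<partial>lborel)"
    using nn_integral_lborel_linear[OF assms(1) \<open>inj T\<close>, of "\<lambda>x. ennreal (std_gauss_density x) * indicator A x"]
    by (simp add: inv_modulus_isometry[OF assms])
  also have "\<dots> = emeasure std_gauss A" by (simp add: std_gauss_def emeasure_density)
  finally show "emeasure (distr std_gauss borel T) A = emeasure std_gauss A" .
qed simp

lemma pair_std_gauss:
  "std_gauss \<Otimes>\<^sub>M std_gauss = (std_gauss :: ('a::euclidean_space \<times> 'b::euclidean_space) measure)"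
proof -
  have dens: "std_gauss_density x * std_gauss_density y = std_gauss_density (x, y)"
    for x :: 'a and y :: 'b
    by (simp add: std_gauss_density_def exp_add[symmetric] power_add real_sqrt_mult
        add_divide_distrib algebra_simps)
  interpret prob_space "std_gauss :: 'b measure" by (rule prob_space_std_gauss)
  have "std_gauss \<Otimes>\<^sub>M std_gauss = density (lborel \<Otimes>\<^sub>M lborel)
      (\<lambda>(x::'a, y::'b). ennreal (std_gauss_density x) * ennreal (std_gauss_density y))"
    unfolding std_gauss_def
    by (rule pair_measure_density)
       (use sigma_finite_measure_axioms in \<open>auto simp: std_gauss_def[symmetric] lborel.sigma_finite_measure_axioms\<close>)
  also have "\<dots> = std_gauss"
    unfolding std_gauss_def lborel_prod
    by (intro arg_cong2[where f=density])
       (auto simp: ennreal_mult[symmetric] std_gauss_density_nonneg dens)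
  finally show ?thesis .
qed

lemma std_gauss_stable:
  fixes a b :: real
  assumes "a\<^sup>2 + b\<^sup>2 = 1"
  shows "distr (std_gauss \<Otimes>\<^sub>M std_gauss) borel (\<lambda>(x, y). a *\<^sub>R x + b *\<^sub>R y) =
    (std_gauss :: 'a::euclidean_space measure)"
proof -
  interpret prob_space "std_gauss :: 'a measure" by (rule prob_space_std_gauss)
  \<comment> \<open>The second component completes the combination to a rotation of the product
    space. The rotated pair is standard Gaussian again, and the wanted law is its first
    marginal.\<close>
  define T where "T = (\<lambda>(x::'a, y). (a *\<^sub>R x + b *\<^sub>R y, (- b) *\<^sub>R x + a *\<^sub>R y))"
  have "linear T" by (auto simp: T_def linear_iff algebra_simps)
  moreover have "norm (T z) = norm z" for z
  proof -
    obtain x y where z: "z = (x, y)" by fastforce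
    have "T z \<bullet> T z = (a\<^sup>2 + b\<^sup>2) * (x \<bullet> x) + (a\<^sup>2 + b\<^sup>2) * (y \<bullet> y)"
      by (simp add: T_def z inner_simps inner_commute[of y x] power2_eq_square algebra_simps)
    also have "\<dots> = z \<bullet> z" by (simp add: assms z)
    finally show ?thesis by (simp add: norm_eq_sqrt_inner)
  qed
  ultimately have T: "distr std_gauss borel T = std_gauss" by (rule distr_std_gauss_isometry)
  have [measurable]: "T \<in> borel \<rightarrow>\<^sub>M borel" using \<open>linear T\<close> by (rule borel_measurable_linear)
  have fst: "(fst :: 'a \<times> 'a \<Rightarrow> 'a) \<in> borel \<rightarrow>\<^sub>M borel"
    by (intro borel_measurable_continuous_onI continuous_intros)
  have "distr (std_gauss \<Otimes>\<^sub>M std_gauss) borel (\<lambda>(x, y). a *\<^sub>R x + b *\<^sub>R y) =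
      distr std_gauss borel (fst \<circ> T)"
    by (simp add: pair_std_gauss) (intro distr_cong, auto simp: T_def)
  also have "\<dots> = distr (distr std_gauss borel T) borel fst"
    by (rule distr_distr[symmetric]) (use fst in auto)
  also have "\<dots> = distr (std_gauss \<Otimes>\<^sub>M (std_gauss :: 'a measure)) (std_gauss :: 'a measure) fst"
    unfolding T pair_std_gauss by (rule distr_cong) auto
  also have "\<dots> = std_gauss" by (rule distr_pair_fst)
  finally show ?thesis .
qed

text \<open>Change of variables y = K x in the density, with det C equal to the square of det K. K
  may be any invertible factor of the covariance, so a Kronecker product can be used later.\<close>

lemma multivariate_normal_eq_distr:
  fixes K :: "real^'k^'k"
  assumes K: "invertible K"
  shows "multivariate_normal 0 (K ** transpose K) = distr std_gauss borel ((*v) K)"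
proof (rule measure_eqI)
  let ?C = "K ** transpose K"
  let ?d = "sqrt ((2 * pi) ^ CARD('k))"
  have lin: "linear ((*v) K)" by simp
  note [measurable] = borel_measurable_linear[OF lin]
  have inj: "inj ((*v) K)" using K by (simp add: inj_matrix_vector_mult)
  have detK: "det K \<noteq> 0" using K by (simp add: invertible_det_nz)
  have C: "invertible ?C" using detK by (simp add: invertible_det_nz det_mul)
  have detC: "sqrt ((2 * pi) ^ CARD('k) * det ?C) = ?d * \<bar>det K\<bar>"
    by (simp add: det_mul det_transpose real_sqrt_mult power2_eq_square[symmetric])
  \<comment> \<open>With w the image of K x under the inverse of C, cancelling K in K K^T w = K x
    leaves K^T w = x, so the form is the inner product of x with K^T w.\<close>
  have quad: "(K *v x) \<bullet> (matrix_inv ?C *v (K *v x)) = x \<bullet> x" for x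
  proof -
    define w where "w = matrix_inv ?C *v (K *v x)"
    have "K *v (transpose K *v w) = (?C ** matrix_inv ?C) *v (K *v x)"
      by (simp add: w_def matrix_vector_mul_assoc matrix_mul_assoc)
    also have "?C ** matrix_inv ?C = mat 1"
      using someI_ex[OF C[unfolded invertible_def]] by (simp add: matrix_inv_def)
    finally have "transpose K *v w = x" using inj by (auto dest: injD)
    then show ?thesis
      using dot_matrix_vector[of w K x] by (simp add: w_def inner_commute)
  qed
  fix A assume "A \<in> sets (multivariate_normal 0 ?C)"
  then have [measurable]: "A \<in> sets borel" by (simp add: multivariate_normal_def)
  define g where "g y = ennreal (exp (- (y \<bullet> (matrix_inv ?C *v y)) / 2) / (?d * \<bar>det K\<bar>)) * indicator A y" for y
  have [measurable]: "(*v) (matrix_inv ?C) \<in> borel \<rightarrow>\<^sub>M borel"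
    by (rule borel_measurable_linear) simp
  have [measurable]: "g \<in> borel_measurable borel" unfolding g_def by measurable
  have [simp]: "(*v) K -` A \<in> sets borel"
    using measurable_sets[OF borel_measurable_linear[OF lin] \<open>A \<in> sets borel\<close>] by simp
  have "emeasure (distr std_gauss borel ((*v) K)) A =
      emeasure (density lborel std_gauss_density) ((*v) K -` A)"
    by (subst emeasure_distr) (auto simp: std_gauss_def)
  also have "\<dots> = (\<integral>\<^sup>+x. ennreal (std_gauss_density x) * indicator A (K *v x) \<partial>lborel)"
    by (subst emeasure_density) (auto simp: indicator_def intro!: nn_integral_cong)
  also have "\<dots> = (\<integral>\<^sup>+x. ennreal \<bar>det K\<bar> * g (K *v x) \<partial>lborel)"
  proof (rule nn_integral_cong)
    fix x :: "real^'k"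
    have "std_gauss_density x = \<bar>det K\<bar> * (exp (- (x \<bullet> x) / 2) / (?d * \<bar>det K\<bar>))"
      using detK by (simp add: std_gauss_density_def)
    then show "ennreal (std_gauss_density x) * indicator A (K *v x) = ennreal \<bar>det K\<bar> * g (K *v x)"
      by (simp only: g_def quad ennreal_mult'[OF abs_ge_zero] mult.assoc)
  qed
  also have "\<dots> = (\<integral>\<^sup>+x. g x \<partial>lborel) * (inv_modulus ((*v) K) * ennreal \<bar>det K\<bar>)"
    by (subst nn_integral_cmult) (simp_all add: nn_integral_lborel_linear[OF lin inj] mult_ac)
  also have "inv_modulus ((*v) K) * ennreal \<bar>det K\<bar> = 1"
    using inv_modulus_det[OF lin inj] by simp
  also have "(\<integral>\<^sup>+x. g x \<partial>lborel) * 1 = emeasure (multivariate_normal 0 ?C) A"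
    unfolding multivariate_normal_def detC mult_1_right diff_zero g_def
    by (rule emeasure_density[symmetric]) measurable
  finally show "emeasure (multivariate_normal 0 ?C) A = emeasure (distr std_gauss borel ((*v) K)) A"
    by simp
qed (simp add: multivariate_normal_def)

subsection \<open>Matrix normal laws\<close>

lemma kronecker_mult: "kronecker A B ** kronecker C D = kronecker (A ** C) (B ** D)"
  by (simp add: kronecker_def matrix_matrix_mult_def vec_eq_iff sum_product sum.cartesian_product
      UNIV_Times_UNIV[symmetric] case_prod_unfold mult_ac del: UNIV_Times_UNIV)

lemma transpose_kronecker: "transpose (kronecker A B) = kronecker (transpose A) (transpose B)"
  by (simp add: kronecker_def transpose_def vec_eq_iff)

lemma kronecker_mat_1: "kronecker (mat 1) (mat 1) = mat 1"
  by (auto simp: kronecker_def mat_def vec_eq_iff prod_eq_iff)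

text \<open>The familiar identity for vec (A X B), adapted to an ordering that lists entries row by
  row: the first Kronecker factor acts on row indices, the second on column indices.\<close>

lemma unvec_kronecker_mult:
  "unvec_transpose (kronecker A B *v v) = A ** unvec_transpose v ** transpose B"
proof -
  have "(\<Sum>p\<in>UNIV. A $ i $ fst p * B $ j $ snd p * v $ p) =
      (\<Sum>l\<in>UNIV. (\<Sum>k\<in>UNIV. A $ i $ k * v $ (k, l)) * B $ j $ l)" for i j
  proof -
    have "(\<Sum>p\<in>UNIV. A $ i $ fst p * B $ j $ snd p * v $ p) =
        (\<Sum>k\<in>UNIV. \<Sum>l\<in>UNIV. A $ i $ k * B $ j $ l * v $ (k, l))"
      by (simp add: sum.cartesian_product case_prod_unfold)
    also have "\<dots> = (\<Sum>l\<in>UNIV. \<Sum>k\<in>UNIV. A $ i $ k * B $ j $ l * v $ (k, l))"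
      by (rule sum.swap)
    finally show ?thesis by (simp add: sum_distrib_left sum_distrib_right mult_ac)
  qed
  then show ?thesis
    by (simp add: kronecker_def unvec_transpose_def matrix_matrix_mult_def matrix_vector_mult_def
        transpose_def vec_eq_iff)
qed

lemma invertible_kronecker:
  assumes "invertible A" "invertible B"
  shows "invertible (kronecker A B)"
proof -
  obtain A' B' where "A ** A' = mat 1" "A' ** A = mat 1" "B ** B' = mat 1" "B' ** B = mat 1"
    using assms unfolding invertible_def by blast
  then show ?thesis
    unfolding invertible_def
    by (intro exI[of _ "kronecker A' B'"]) (simp add: kronecker_mult kronecker_mat_1)
qed

lemma sym_pos_def_invertible:
  assumes "sym_pos_def A"
  shows "invertible A"
proof -
  have "x = 0" if "A *v x = 0" for x
    using assms that unfolding sym_pos_def_def by (metis inner_zero_right less_irrefl)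
  then show ?thesis
    by (simp add: invertible_left_inverse matrix_left_invertible_ker)
qed

lemma linear_sandwich: "linear (\<lambda>Z :: real^'d^'n. A ** Z ** B)"
  by (auto simp: linear_iff matrix_matrix_mult_def vec_eq_iff sum.distrib[symmetric]
      sum_distrib_left sum_distrib_right distrib_left distrib_right mult_ac)

lemma matrix_normal_eq_distr:
  fixes \<Psi> :: "real^'n^'n" and \<Sigma> :: "real^'d^'d"
  assumes "sym_pos_def \<Psi>" and "sym_pos_def \<Sigma>"
  shows "matrix_normal 0 \<Psi> \<Sigma> =
    distr std_gauss borel (\<lambda>v. sym_sqrt \<Psi> ** unvec_transpose v ** sym_sqrt \<Sigma>)"
proof -
  \<comment> \<open>By the mixed product rule the Kronecker product of the two roots is a factor of
    the covariance.\<close>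
  let ?K = "kronecker (sym_sqrt \<Psi>) (sym_sqrt \<Sigma>)"
  have "invertible ?K"
    by (intro invertible_kronecker sym_pos_def_invertible sym_sqrt_works(3) assms)
  moreover have "?K ** transpose ?K = kronecker \<Psi> \<Sigma>"
    by (simp add: transpose_kronecker kronecker_mult sym_sqrt_works assms)
  moreover have "vec_transpose (0 :: real^'d^'n) = 0" by (simp add: vec_transpose_def vec_eq_iff)
  ultimately have "matrix_normal 0 \<Psi> \<Sigma> = distr (distr std_gauss borel ((*v) ?K)) borel unvec_transpose"
    using multivariate_normal_eq_distr[of ?K] by (simp add: matrix_normal_def)
  also have "\<dots> = distr std_gauss borel (unvec_transpose \<circ> (*v) ?K)"
    by (rule distr_distr) (auto intro!: borel_measurable_linear simp: measurable_unvec_transpose)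
  also have "unvec_transpose \<circ> (*v) ?K = (\<lambda>v. sym_sqrt \<Psi> ** unvec_transpose v ** sym_sqrt \<Sigma>)"
    by (simp add: fun_eq_iff unvec_kronecker_mult sym_sqrt_works assms)
  finally show ?thesis .
qed

lemma std_matrix_normal_eq_distr:
  "(std_matrix_normal :: (real^'d^'n) measure) = distr std_gauss borel unvec_transpose"
proof -
  have "vec_transpose (0 :: real^'d^'n) = 0" by (simp add: vec_transpose_def vec_eq_iff)
  moreover have "distr std_gauss borel ((*v) (mat 1)) = (std_gauss :: (real^('n \<times> 'd)) measure)"
    using distr_id2[of borel "std_gauss :: (real^('n \<times> 'd)) measure"]
    by (simp add: fun_eq_iff[THEN iffD2, OF allI, OF matrix_vector_mul_lid])
  ultimately show ?thesis
    using multivariate_normal_eq_distr[of "mat 1 :: real^('n \<times> 'd)^('n \<times> 'd)"]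
    by (simp add: matrix_normal_def kronecker_mat_1 invertible_def exI[of _ "mat 1"] transpose_mat)
qed

text \<open>The noise term in \<open>ou_state\<close> thus has the stationary law itself, so the
  semigroup can be written with \<Psi> and \<Sigma> hidden in the measure.\<close>

lemma distr_std_matrix_normal:
  fixes \<Psi> :: "real^'n^'n" and \<Sigma> :: "real^'d^'d"
  assumes "sym_pos_def \<Psi>" and "sym_pos_def \<Sigma>"
  shows "distr std_matrix_normal borel (\<lambda>Z. sym_sqrt \<Psi> ** Z ** sym_sqrt \<Sigma>) = matrix_normal 0 \<Psi> \<Sigma>"
proof -
  have "distr std_matrix_normal borel (\<lambda>Z. sym_sqrt \<Psi> ** Z ** sym_sqrt \<Sigma>) =
     distr std_gauss borel ((\<lambda>Z. sym_sqrt \<Psi> ** Z ** sym_sqrt \<Sigma>) \<circ> unvec_transpose)"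
    unfolding std_matrix_normal_eq_distr
    by (rule distr_distr) (auto simp: measurable_unvec_transpose intro!: borel_measurable_linear linear_sandwich)
  then show ?thesis by (simp add: matrix_normal_eq_distr[OF assms] o_def)
qed

subsection \<open>Mehler semigroups\<close>

lemma powr_le_add_one:
  fixes r :: real
  assumes "0 \<le> r" "0 < a" "a \<le> 1"
  shows "r powr a \<le> 1 + r"
proof (cases "r \<le> 1")
  case True
  then have "r powr a \<le> 1 powr a" using assms by (intro powr_mono2) auto
  then show ?thesis using assms by simp
next
  case False
  then have "r powr a \<le> r powr 1" using assms by (intro powr_mono) auto
  then show ?thesis using False by simp
qed

text \<open>The summand 1 keeps weights at least one: powers grow with the exponent, and the weight
  of a sum is at most the product of the weights.\<close>

abbreviation weight :: "'a::real_normed_vector \<Rightarrow> real" where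
  "weight x \<equiv> 1 + norm x"

lemma weight_combination_le:
  assumes "\<bar>a\<bar> \<le> 1" "\<bar>b\<bar> \<le> 1"
  shows "weight (a *\<^sub>R x + b *\<^sub>R y) \<le> weight x * weight y"
proof -
  have "norm (a *\<^sub>R x + b *\<^sub>R y) \<le> \<bar>a\<bar> * norm x + \<bar>b\<bar> * norm y"
    by (metis norm_scaleR norm_triangle_ineq)
  also have "\<dots> \<le> 1 * norm x + 1 * norm y"
    using assms by (intro add_mono mult_right_mono) auto
  finally have "norm (a *\<^sub>R x + b *\<^sub>R y) \<le> norm x + norm y" by simp
  moreover have "0 \<le> norm x * norm y" by simp
  ultimately show ?thesis unfolding ring_distribs by linarith
qed

text \<open>Used with c = \<open>exp (- t)\<close> for the decay in time, and with a c that tends to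
  0 as t does for the continuity at time zero.\<close>

lemma norm_combination_powr_le:
  assumes "0 < \<alpha>" "\<alpha> \<le> 1" "0 \<le> c" "\<bar>a\<bar> \<le> c" "\<bar>b\<bar> \<le> c"
  shows "norm (a *\<^sub>R x + b *\<^sub>R y) powr \<alpha> \<le> c powr \<alpha> * (weight x * weight y)"
proof -
  have "norm (a *\<^sub>R x + b *\<^sub>R y) \<le> \<bar>a\<bar> * norm x + \<bar>b\<bar> * norm y"
    by (metis norm_scaleR norm_triangle_ineq)
  also have "\<dots> \<le> c * norm x + c * norm y"
    using assms by (intro add_mono mult_right_mono) auto
  finally have "norm (a *\<^sub>R x + b *\<^sub>R y) powr \<alpha> \<le> (c * (norm x + norm y)) powr \<alpha>"
    using assms by (intro powr_mono2) (auto simp: distrib_left)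
  also have "\<dots> = c powr \<alpha> * (norm x + norm y) powr \<alpha>" using assms by (simp add: powr_mult)
  also have "\<dots> \<le> c powr \<alpha> * (1 + (norm x + norm y))"
    using assms by (intro mult_left_mono powr_le_add_one) auto
  also have "\<dots> \<le> c powr \<alpha> * (weight x * weight y)"
    using mult_nonneg_nonneg[of "norm x" "norm y"] by (intro mult_left_mono) (auto simp: algebra_simps)
  finally show ?thesis .
qed

lemma has_bochner_integral_exp_Ici:
  assumes "0 < (u::real)"
  shows "has_bochner_integral lborel (\<lambda>x. indicator {0..} x * exp (- u * x)) (1 / u)"
proof -
  have "has_bochner_integral lborel (\<lambda>x. x^0 * exp (-x) * indicator {0 ..} x::real) (fact 0)"
    using nn_intergal_power_times_exp_Ici[of 0]
    by (intro has_bochner_integral_nn_integral)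
       (auto simp: nn_integral_set_ennreal split: split_indicator)
  then have "has_bochner_integral lborel (\<lambda>x. exp (-x) * indicator {0 ..} x::real) 1" by simp
  then have i: "integrable lborel (\<lambda>x. exp (-x) * indicator {0 ..} x::real)"
      "(LBINT x. exp (-x) * indicator {0 ..} x :: real) = 1"
    by (auto simp: has_bochner_integral_iff)
  have eq: "exp (-(0 + u * x)) * indicator {0 ..} (0 + u * x) = indicator {0..} x * exp (- u * x)" for x
    using assms by (auto simp: indicator_def zero_le_mult_iff)
  have "integrable lborel (\<lambda>x. indicator {0..} x * exp (- u * x))"
    using lborel_integrable_real_affine[OF i(1), of u 0] assms unfolding eq by simp
  moreover have "1 = u * (LBINT x. indicator {0..} x * exp (- u * x))"
    using lborel_integral_real_affine[of u "\<lambda>x. exp (-x) * indicator {0 ..} x" 0] assms i(2) unfolding eq by simp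
  ultimately show ?thesis
    using assms by (simp add: has_bochner_integral_iff field_simps)
qed

text \<open>The three conclusions serve different ends: existence of the time integral, the L1 bound
  for Fubini, and the pointwise bound, where the rate u becomes the factor 1 / u.\<close>

lemma exp_decay_integral:
  fixes f :: "real \<Rightarrow> real"
  assumes [measurable]: "f \<in> borel_measurable borel" and "0 < u"
    and f: "\<And>t. 0 \<le> t \<Longrightarrow> \<bar>f t\<bar> \<le> K * exp (- u * t)"
  shows "set_integrable lborel {0..} f" "(LBINT t. norm (indicator {0..} t *\<^sub>R f t)) \<le> K / u"
    "\<bar>LBINT t:{0..}. f t\<bar> \<le> K / u"
proof -
  let ?g = "\<lambda>t. K * (indicator {0..} t * exp (- u * t))"
  have g: "integrable lborel ?g" "(LBINT t. ?g t) = K / u"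
    using has_bochner_integral_exp_Ici[OF \<open>0 < u\<close>] by (auto simp: has_bochner_integral_iff)
  have le: "norm (indicator {0..} t *\<^sub>R f t) \<le> ?g t" for t
    using f[of t] by (simp add: indicator_def)
  show i: "set_integrable lborel {0..} f"
    unfolding set_integrable_def
  proof (rule Bochner_Integration.integrable_bound[OF g(1)])
    show "AE t in lborel. norm (indicator {0..} t *\<^sub>R f t) \<le> norm (?g t)"
      by (intro AE_I2 order_trans[OF le]) (simp only: real_norm_def abs_ge_self)
  qed measurable
  have "(LBINT t. norm (indicator {0..} t *\<^sub>R f t)) \<le> (LBINT t. ?g t)"
    using i le g(1) unfolding set_integrable_def by (intro integral_mono integrable_norm) auto
  then show *: "(LBINT t. norm (indicator {0..} t *\<^sub>R f t)) \<le> K / u" by (simp only: g)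
  show "\<bar>LBINT t:{0..}. f t\<bar> \<le> K / u"
    using order_trans[OF integral_norm_bound *] by (simp add: set_lebesgue_integral_def)
qed

text \<open>Moments of every order are assumed because the growth exponent of a
  \<open>Lip_class\<close> function depends on the function.\<close>

locale mehler_law = prob_space M for M :: "'a::euclidean_space measure" +
  assumes sets_M [simp, measurable_cong]: "sets M = sets borel"
    and moments: "integrable M (\<lambda>x. weight x ^ q)"
    and stable: "a\<^sup>2 + b\<^sup>2 = 1 \<Longrightarrow> distr (M \<Otimes>\<^sub>M M) borel (\<lambda>(x, y). a *\<^sub>R x + b *\<^sub>R y) = M"
begin

sublocale pair: pair_sigma_finite M M ..

lemma space_M [simp]: "space M = UNIV"
  using sets_eq_imp_space_eq[OF sets_M] by simp

lemma prob_UNIV [simp]: "prob UNIV = 1"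
  using prob_space by (simp only: space_M)

text \<open>\<open>ou_semigroup\<close> transforms standard noise by the square roots; here the
  noise already has the covariance of M.\<close>

definition mehler :: "real \<Rightarrow> ('a \<Rightarrow> real) \<Rightarrow> 'a \<Rightarrow> real" where
  "mehler t h X = (\<integral>Y. h (exp (- t) *\<^sub>R X + sqrt (1 - exp (- 2 * t)) *\<^sub>R Y) \<partial>M)"

lemma integral_stable:
  fixes g :: "'a \<Rightarrow> real"
  assumes [measurable]: "g \<in> borel_measurable borel" and "c \<ge> 0" and c: "a\<^sup>2 + b\<^sup>2 = c\<^sup>2"
  shows "(\<integral>z. g (a *\<^sub>R fst z + b *\<^sub>R snd z) \<partial>(M \<Otimes>\<^sub>M M)) = (\<integral>y. g (c *\<^sub>R y) \<partial>M)"
\<comment> \<open>Stability is applied after division by c. The value 0 does occur, in the semigroup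
  law at s = t = 0.\<close>
proof (cases "c = 0")
  case True
  interpret P: prob_space "M \<Otimes>\<^sub>M M" by (rule prob_space_pair) unfold_locales
  have "a = 0 \<and> b = 0" using c True by (simp add: sum_power2_eq_zero_iff)
  then show ?thesis using True by (simp add: prob_space P.prob_space)
next
  case False
  then have "(a / c)\<^sup>2 + (b / c)\<^sup>2 = 1"
    using c by (simp add: power_divide add_divide_distrib[symmetric])
  from stable[OF this] have "(\<integral>y. g (c *\<^sub>R y) \<partial>M) =
      (\<integral>y. g (c *\<^sub>R y) \<partial>distr (M \<Otimes>\<^sub>M M) borel (\<lambda>(x, y). (a / c) *\<^sub>R x + (b / c) *\<^sub>R y))"
    by simp
  also have "\<dots> = (\<integral>z. g (a *\<^sub>R fst z + b *\<^sub>R snd z) \<partial>(M \<Otimes>\<^sub>M M))"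
    using False by (subst integral_distr) (auto simp: case_prod_unfold scaleR_add_right)
  finally show ?thesis by simp
qed

lemma integrable_weight_product:
  "integrable (M \<Otimes>\<^sub>M M) (\<lambda>z. weight (fst z) ^ p * weight (snd z) ^ q)"
proof (rule pair.Fubini_integrable)
  show "AE x in M. integrable M (\<lambda>y. weight (fst (x, y)) ^ p * weight (snd (x, y)) ^ q)"
    using moments by simp
  have "integrable M (\<lambda>x. weight x ^ p * (\<integral>y. weight y ^ q \<partial>M))" using moments by simp
  then show "integrable M (\<lambda>x. \<integral>y. norm (weight (fst (x, y)) ^ p * weight (snd (x, y)) ^ q) \<partial>M)"
    by (simp add: abs_mult)
qed measurable

lemma integral_weight_product:
  "(\<integral>z. weight (fst z) ^ p * weight (snd z) ^ q \<partial>(M \<Otimes>\<^sub>M M)) =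
     (\<integral>x. weight x ^ p \<partial>M) * (\<integral>x. weight x ^ q \<partial>M)"
  using pair.integral_fst'[OF integrable_weight_product, of p q] by simp

lemma integrable_combination:
  fixes f :: "'a \<Rightarrow> real"
  assumes [measurable]: "f \<in> borel_measurable borel"
    and f: "\<And>x. \<bar>f x\<bar> \<le> B * weight x ^ q" and ab: "\<bar>a\<bar> \<le> 1" "\<bar>b\<bar> \<le> 1"
  shows "integrable M (\<lambda>y. f (a *\<^sub>R x + b *\<^sub>R y))"
proof (rule Bochner_Integration.integrable_bound)
  have "0 \<le> B" using order_trans[OF abs_ge_zero f[of 0]] by simp
  have bound: "\<bar>f (a *\<^sub>R x + b *\<^sub>R y)\<bar> \<le> B * weight x ^ q * weight y ^ q" for y
  proof -
    have "\<bar>f (a *\<^sub>R x + b *\<^sub>R y)\<bar> \<le> B * weight (a *\<^sub>R x + b *\<^sub>R y) ^ q" by (rule f)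
    also have "\<dots> \<le> B * (weight x * weight y) ^ q"
      using \<open>0 \<le> B\<close> by (intro mult_left_mono power_mono weight_combination_le ab) auto
    finally show ?thesis by (simp add: power_mult_distrib mult_ac)
  qed
  show "AE y in M. norm (f (a *\<^sub>R x + b *\<^sub>R y)) \<le> norm (B * weight x ^ q * weight y ^ q)"
    unfolding real_norm_def by (intro AE_I2 order_trans[OF bound abs_ge_self])
  show "integrable M (\<lambda>y. B * weight x ^ q * weight y ^ q)" using moments by simp
qed measurable

text \<open>Suitable coefficients yield all integrands on the product space: the process started at
  a point, the stationary one, and two consecutive time steps.\<close>

lemma integrable_pair_combination:
  fixes f :: "'a \<Rightarrow> real"
  assumes [measurable]: "f \<in> borel_measurable borel"
    and f: "\<And>x. \<bar>f x\<bar> \<le> B * weight x ^ q" and ab: "\<bar>a\<bar> \<le> 1" "\<bar>b\<bar> \<le> 1" "\<bar>c\<bar> \<le> 1"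
  shows "integrable (M \<Otimes>\<^sub>M M) (\<lambda>z. f (a *\<^sub>R x + (b *\<^sub>R fst z + c *\<^sub>R snd z)))"
proof (rule Bochner_Integration.integrable_bound)
  have "0 \<le> B" using order_trans[OF abs_ge_zero f[of 0]] by simp
  have bound: "\<bar>f (a *\<^sub>R x + (b *\<^sub>R y + c *\<^sub>R z))\<bar> \<le> B * weight x ^ q * (weight y ^ q * weight z ^ q)" for y z
  proof -
    have "\<bar>f (a *\<^sub>R x + 1 *\<^sub>R (b *\<^sub>R y + c *\<^sub>R z))\<bar> \<le> B * weight (a *\<^sub>R x + 1 *\<^sub>R (b *\<^sub>R y + c *\<^sub>R z)) ^ q"
      by (rule f)
    also have "\<dots> \<le> B * (weight x * weight (b *\<^sub>R y + c *\<^sub>R z)) ^ q"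
      using \<open>0 \<le> B\<close> by (intro mult_left_mono power_mono weight_combination_le ab) auto
    also have "\<dots> \<le> B * (weight x * (weight y * weight z)) ^ q"
      using \<open>0 \<le> B\<close> by (intro mult_left_mono power_mono weight_combination_le ab) auto
    finally show ?thesis by (simp add: power_mult_distrib mult_ac)
  qed
  show "AE z in M \<Otimes>\<^sub>M M. norm (f (a *\<^sub>R x + (b *\<^sub>R fst z + c *\<^sub>R snd z)))
      \<le> norm (B * weight x ^ q * (weight (fst z) ^ q * weight (snd z) ^ q))"
    unfolding real_norm_def by (intro AE_I2 order_trans[OF bound abs_ge_self])
  show "integrable (M \<Otimes>\<^sub>M M) (\<lambda>z. B * weight x ^ q * (weight (fst z) ^ q * weight (snd z) ^ q))"
    by (intro integrable_mult_right integrable_weight_product)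
qed measurable

lemma mehler_coeffs:
  assumes "0 \<le> t"
  shows "\<bar>exp (- t)\<bar> \<le> (1::real)" "\<bar>sqrt (1 - exp (- 2 * t))\<bar> \<le> (1::real)"
    "(exp (- t))\<^sup>2 + (sqrt (1 - exp (- 2 * t)))\<^sup>2 = (1::real)"
  using assms by (auto simp: exp_double[symmetric])

end

text \<open>Both kinds of test functions satisfy this growth condition: \<open>p = 0\<close> for Hoelder functions,
  \<open>\<alpha> = 1\<close> for functions with a Lipschitz derivative of some order.\<close>

locale mehler_test = mehler_law +
  fixes h :: "'a \<Rightarrow> real" and C \<alpha> :: real and p :: nat
  assumes \<alpha>: "0 < \<alpha>" "\<alpha> \<le> 1"
    and growth: "\<bar>h X - h Y\<bar> \<le> C * (weight X * weight Y) ^ p * norm (X - Y) powr \<alpha>"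
begin

text \<open>The locale leaves the sign of C open; comparing 0 with a unit vector settles it.\<close>

lemma C_nonneg: "0 \<le> C"
proof -
  obtain u :: 'a where u: "norm u = 1" using vector_choose_size[of 1] by auto
  have "0 \<le> \<bar>h u - h 0\<bar>" by simp
  also have "\<dots> \<le> C * (weight u * weight (0::'a)) ^ p * norm (u - 0) powr \<alpha>" by (rule growth)
  finally have *: "0 \<le> C * 2 ^ p" using u by simp
  show ?thesis
  proof (rule ccontr)
    assume "\<not> 0 \<le> C"
    then have "C * 2 ^ p < 0" by (intro mult_neg_pos) auto
    with * show False by simp
  qed
qed

lemma continuous_h: "continuous_on UNIV h"
  unfolding continuous_on_eq_continuous_at[OF open_UNIV]
proof (rule ballI)
  fix X :: 'a
  have 1: "((\<lambda>Y. norm (X - Y) powr \<alpha>) \<longlongrightarrow> 0) (at X)"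
    using \<alpha> by (intro tendsto_zero_powrI[of _ _ "\<lambda>_. \<alpha>" \<alpha>]) (auto intro!: tendsto_eq_intros)
  have "((\<lambda>Y. C * (weight X * weight Y) ^ p * norm (X - Y) powr \<alpha>) \<longlongrightarrow> C * (weight X * weight X) ^ p * 0) (at X)"
    by (intro tendsto_intros 1)
  then have 2: "((\<lambda>Y. C * (weight X * weight Y) ^ p * norm (X - Y) powr \<alpha>) \<longlongrightarrow> 0) (at X)"
    by simp
  have "((\<lambda>Y. h X - h Y) \<longlongrightarrow> 0) (at X)"
    by (rule Lim_null_comparison[OF always_eventually 2]) (unfold real_norm_def, intro allI growth)
  then have "((\<lambda>Y. h X - (h X - h Y)) \<longlongrightarrow> h X - 0) (at X)"
    by (intro tendsto_intros)
  then show "isCont h X" by (simp add: isCont_def)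
qed

lemma borel_measurable_h [measurable]: "h \<in> borel_measurable borel"
  using continuous_h by (rule borel_measurable_continuous_onI)

text \<open>The exponent \<open>Suc p\<close> arises because the increment from 0 contributes
  \<open>norm X powr \<alpha>\<close>, which costs one further weight.\<close>

lemma h_bound: "\<bar>h X\<bar> \<le> (\<bar>h 0\<bar> + C) * weight X ^ Suc p"
proof -
  have "\<bar>h X - h 0\<bar> \<le> C * (weight X * weight (0::'a)) ^ p * norm (X - 0) powr \<alpha>" by (rule growth)
  also have "\<dots> \<le> C * (weight X * weight (0::'a)) ^ p * weight X"
    using \<alpha> C_nonneg powr_le_add_one[of "norm X" \<alpha>] by (intro mult_left_mono) auto
  finally have 1: "\<bar>h X - h 0\<bar> \<le> C * weight X ^ Suc p" by (simp add: mult_ac)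
  have "\<bar>h 0\<bar> * 1 \<le> \<bar>h 0\<bar> * weight X ^ Suc p"
    by (intro mult_left_mono one_le_power) auto
  with 1 show ?thesis unfolding distrib_right by linarith
qed

lemma integrable_h_combination:
  "\<bar>a\<bar> \<le> 1 \<Longrightarrow> \<bar>b\<bar> \<le> 1 \<Longrightarrow> integrable M (\<lambda>y. h (a *\<^sub>R x + b *\<^sub>R y))"
  by (rule integrable_combination[OF borel_measurable_h h_bound])

lemma integrable_h: "integrable M h"
  using integrable_h_combination[of 0 1 0] by simp

text \<open>Exponents from the coupling estimate: the stationary start enters one growth weight and
  the increment, hence \<open>Suc p\<close>; the shared noise enters both growth weights but cancels
  in the increment, hence \<open>2 * p\<close>.\<close>

definition decay_const :: real where
  "decay_const = C * (\<integral>y. weight y ^ Suc p \<partial>M) * (\<integral>y. weight y ^ (2 * p) \<partial>M)"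

lemma decay_const_nonneg: "0 \<le> decay_const"
  unfolding decay_const_def using C_nonneg by (intro mult_nonneg_nonneg integral_nonneg_AE) auto

text \<open>The first coordinate is idle here. It carries the stationary start in
  \<open>stationary_eq_pair\<close>, and the common second coordinate allows the two means to be
  subtracted under one integral.\<close>

lemma mehler_eq_pair:
  assumes "0 \<le> t"
  shows "mehler t h X = (\<integral>z. h (exp (- t) *\<^sub>R X + sqrt (1 - exp (- 2 * t)) *\<^sub>R snd z) \<partial>(M \<Otimes>\<^sub>M M))"
    "integrable (M \<Otimes>\<^sub>M M) (\<lambda>z. h (exp (- t) *\<^sub>R X + sqrt (1 - exp (- 2 * t)) *\<^sub>R snd z))"
proof -
  let ?a = "exp (- t)" and ?b = "sqrt (1 - exp (- 2 * t))"
  show i: "integrable (M \<Otimes>\<^sub>M M) (\<lambda>z. h (?a *\<^sub>R X + ?b *\<^sub>R snd z))"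
    using integrable_pair_combination[OF borel_measurable_h h_bound, of ?a 0 ?b X] mehler_coeffs[OF assms]
    by simp
  show "mehler t h X = (\<integral>z. h (?a *\<^sub>R X + ?b *\<^sub>R snd z) \<partial>(M \<Otimes>\<^sub>M M))"
    using pair.integral_fst'[OF i] by (simp add: mehler_def prob_space)
qed

lemma stationary_eq_pair:
  assumes "0 \<le> t"
  shows "(\<integral>y. h y \<partial>M) = (\<integral>z. h (exp (- t) *\<^sub>R fst z + sqrt (1 - exp (- 2 * t)) *\<^sub>R snd z) \<partial>(M \<Otimes>\<^sub>M M))"
    "integrable (M \<Otimes>\<^sub>M M) (\<lambda>z. h (exp (- t) *\<^sub>R fst z + sqrt (1 - exp (- 2 * t)) *\<^sub>R snd z))"
proof -
  let ?a = "exp (- t)" and ?b = "sqrt (1 - exp (- 2 * t))"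
  show "integrable (M \<Otimes>\<^sub>M M) (\<lambda>z. h (?a *\<^sub>R fst z + ?b *\<^sub>R snd z))"
    using integrable_pair_combination[OF borel_measurable_h h_bound, of 1 ?a ?b 0] mehler_coeffs[OF assms]
    by simp
  show "(\<integral>y. h y \<partial>M) = (\<integral>z. h (?a *\<^sub>R fst z + ?b *\<^sub>R snd z) \<partial>(M \<Otimes>\<^sub>M M))"
    using integral_stable[OF borel_measurable_h, of 1 ?a ?b] mehler_coeffs(3)[OF assms] by simp
qed

text \<open>Couple \<open>X\<close> with an independent stationary start \<open>Y'\<close>, driving both by the same noise.\<close>

lemma mehler_decay:
  assumes "0 \<le> t"
  shows "\<bar>mehler t h X - (\<integral>y. h y \<partial>M)\<bar> \<le> decay_const * weight X ^ Suc p * exp (- \<alpha> * t)"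
proof -
  let ?a = "exp (- t)" and ?b = "sqrt (1 - exp (- 2 * t))"
  note ab = mehler_coeffs[OF assms]
  have "\<bar>mehler t h X - (\<integral>y. h y \<partial>M)\<bar> =
      \<bar>\<integral>z. h (?a *\<^sub>R X + ?b *\<^sub>R snd z) - h (?a *\<^sub>R fst z + ?b *\<^sub>R snd z) \<partial>(M \<Otimes>\<^sub>M M)\<bar>"
    by (subst Bochner_Integration.integral_diff[OF mehler_eq_pair(2)[OF assms] stationary_eq_pair(2)[OF assms]])
       (simp only: mehler_eq_pair(1)[OF assms] stationary_eq_pair(1)[OF assms])
  also have "\<dots> \<le> (\<integral>z. \<bar>h (?a *\<^sub>R X + ?b *\<^sub>R snd z) - h (?a *\<^sub>R fst z + ?b *\<^sub>R snd z)\<bar> \<partial>(M \<Otimes>\<^sub>M M))"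
    by (rule integral_abs_bound)
  also have "\<dots> \<le> (\<integral>z. C * exp (- \<alpha> * t) * weight X ^ Suc p *
      (weight (fst z) ^ Suc p * weight (snd z) ^ (2 * p)) \<partial>(M \<Otimes>\<^sub>M M))"
  proof (rule integral_mono)
    fix z :: "'a \<times> 'a"
    obtain y' y where z: "z = (y', y)" by fastforce
    let ?w = "weight :: 'a \<Rightarrow> real"
    have "\<bar>h (?a *\<^sub>R X + ?b *\<^sub>R y) - h (?a *\<^sub>R y' + ?b *\<^sub>R y)\<bar> \<le>
       C * (?w (?a *\<^sub>R X + ?b *\<^sub>R y) * ?w (?a *\<^sub>R y' + ?b *\<^sub>R y)) ^ p *
         norm ((?a *\<^sub>R X + ?b *\<^sub>R y) - (?a *\<^sub>R y' + ?b *\<^sub>R y)) powr \<alpha>"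
      by (rule growth)
    also have "(?a *\<^sub>R X + ?b *\<^sub>R y) - (?a *\<^sub>R y' + ?b *\<^sub>R y) = ?a *\<^sub>R X + (- ?a) *\<^sub>R y'" by simp
    also have "C * (?w (?a *\<^sub>R X + ?b *\<^sub>R y) * ?w (?a *\<^sub>R y' + ?b *\<^sub>R y)) ^ p *
        norm (?a *\<^sub>R X + (- ?a) *\<^sub>R y') powr \<alpha>
      \<le> C * ((?w X * ?w y) * (?w y' * ?w y)) ^ p * (?a powr \<alpha> * (?w X * ?w y'))"
      using C_nonneg \<alpha> ab
      by (intro mult_mono power_mono weight_combination_le norm_combination_powr_le mult_nonneg_nonneg zero_le_power)
         (auto intro!: add_nonneg_nonneg)
    also have "?a powr \<alpha> = exp (- \<alpha> * t)" by (simp add: powr_def)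
    also have "C * ((?w X * ?w y) * (?w y' * ?w y)) ^ p * (exp (- \<alpha> * t) * (?w X * ?w y')) =
        C * exp (- \<alpha> * t) * ?w X ^ Suc p * (?w y' ^ Suc p * ?w y ^ (2 * p))"
      by (simp only: power_mult_distrib mult_2 mult_2_right power_add power_Suc mult_ac)
    finally show "\<bar>h (?a *\<^sub>R X + ?b *\<^sub>R snd z) - h (?a *\<^sub>R fst z + ?b *\<^sub>R snd z)\<bar> \<le>
        C * exp (- \<alpha> * t) * weight X ^ Suc p * (weight (fst z) ^ Suc p * weight (snd z) ^ (2 * p))"
      by (simp only: z fst_conv snd_conv)
  next
    show "integrable (M \<Otimes>\<^sub>M M)
        (\<lambda>z. \<bar>h (?a *\<^sub>R X + ?b *\<^sub>R snd z) - h (?a *\<^sub>R fst z + ?b *\<^sub>R snd z)\<bar>)"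
      by (intro integrable_abs Bochner_Integration.integrable_diff
          mehler_eq_pair(2)[OF assms] stationary_eq_pair(2)[OF assms])
    show "integrable (M \<Otimes>\<^sub>M M) (\<lambda>z. C * exp (- \<alpha> * t) * weight X ^ Suc p *
        (weight (fst z) ^ Suc p * weight (snd z) ^ (2 * p)))"
      by (rule integrable_mult_right[OF integrable_weight_product])
  qed
  also have "\<dots> = decay_const * weight X ^ Suc p * exp (- \<alpha> * t)"
    by (subst integral_mult_right_zero, subst integral_weight_product) (simp add: decay_const_def mult_ac)
  finally show ?thesis .
qed

section \<open>Semigroup property and continuity at time zero\<close>

lemma mehler_semigroup:
  assumes "0 \<le> s" "0 \<le> t"
  shows "mehler s (mehler t h) X = mehler (s + t) h X"
proof -
  let ?a = "\<lambda>t. exp (- t)" and ?b = "\<lambda>t. sqrt (1 - exp (- 2 * t))"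
  note ab = mehler_coeffs[OF assms(1)] mehler_coeffs[OF assms(2)]
  have c1: "\<bar>?a t * ?a s\<bar> \<le> 1" "\<bar>?a t * ?b s\<bar> \<le> 1"
    unfolding abs_mult using ab by (auto intro!: mult_le_one simp del: abs_exp_cancel)
  \<comment> \<open>Variances of the two noises add up: e^(-2t) (1 - e^(-2s)) + (1 - e^(-2t)) = 1 -
    e^(-2(s+t)).\<close>
  have c2: "(?a t * ?b s)\<^sup>2 + (?b t)\<^sup>2 = (?b (s + t))\<^sup>2"
    using assms by (simp add: power_mult_distrib exp_double[symmetric] algebra_simps exp_add[symmetric])
  have "mehler s (mehler t h) X =
      (\<integral>y. \<integral>y'. h ((?a t * ?a s) *\<^sub>R X + ((?a t * ?b s) *\<^sub>R y + ?b t *\<^sub>R y')) \<partial>M \<partial>M)"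
    by (simp add: mehler_def algebra_simps)
  also have "\<dots> = (\<integral>z. h ((?a t * ?a s) *\<^sub>R X + ((?a t * ?b s) *\<^sub>R fst z + ?b t *\<^sub>R snd z)) \<partial>(M \<Otimes>\<^sub>M M))"
    using pair.integral_fst'[OF integrable_pair_combination[OF borel_measurable_h h_bound c1 ab(5)]]
    by simp
  also have "\<dots> = (\<integral>y. h ((?a t * ?a s) *\<^sub>R X + ?b (s + t) *\<^sub>R y) \<partial>M)"
    using assms by (intro integral_stable[of "\<lambda>y. h ((?a t * ?a s) *\<^sub>R X + y)"] c2) auto
  also have "?a t * ?a s = ?a (s + t)" by (simp add: exp_add[symmetric])
  finally show ?thesis by (simp add: mehler_def)
qed

lemma mehler_0: "mehler 0 h X = h X"
  by (simp add: mehler_def prob_space)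

lemma tendsto_mehler_0: "((\<lambda>t. mehler t h X) \<longlongrightarrow> h X) (at_right 0)"
proof -
  \<comment> \<open>X contributes p from its own weight, p from the weight of the moved point and 1
    from the increment; the noise contributes p and 1.\<close>
  define K where "K = C * weight X ^ (2 * p + 1) * (\<integral>y. weight y ^ Suc p \<partial>M)"
  let ?b = "\<lambda>t. sqrt (1 - exp (- 2 * t))"
  \<comment> \<open>A common bound for the coefficients \<open>exp (- t) - 1\<close> and
    \<open>sqrt (1 - exp (- 2 * t))\<close> of the increment.\<close>
  let ?c = "\<lambda>t::real. (1 - exp (- t)) + ?b t"
  have bound: "\<bar>mehler t h X - h X\<bar> \<le> K * ?c t powr \<alpha>" if "0 \<le> t" for t
  proof -
    let ?a = "exp (- t)" and ?b = "sqrt (1 - exp (- 2 * t))"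
    note ab = mehler_coeffs[OF that]
    have "\<bar>mehler t h X - h X\<bar> = \<bar>\<integral>y. h (?a *\<^sub>R X + ?b *\<^sub>R y) - h X \<partial>M\<bar>"
      unfolding mehler_def using integrable_h_combination[OF ab(1,2)] by (simp add: prob_space)
    also have "\<dots> \<le> (\<integral>y. \<bar>h (?a *\<^sub>R X + ?b *\<^sub>R y) - h X\<bar> \<partial>M)"
      by (rule integral_abs_bound)
    also have "\<dots> \<le> (\<integral>y. C * weight X ^ (2 * p + 1) * ?c t powr \<alpha> * weight y ^ Suc p \<partial>M)"
    proof (rule integral_mono)
      show "integrable M (\<lambda>y. \<bar>h (?a *\<^sub>R X + ?b *\<^sub>R y) - h X\<bar>)"
        using integrable_h_combination[OF ab(1,2)] by simp
      show "integrable M (\<lambda>y. C * weight X ^ (2 * p + 1) * ?c t powr \<alpha> * weight y ^ Suc p)"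
        using moments by (intro integrable_mult_right)
      fix y
      let ?w = "weight :: 'a \<Rightarrow> real"
      have "\<bar>h (?a *\<^sub>R X + ?b *\<^sub>R y) - h X\<bar> \<le>
        C * (?w (?a *\<^sub>R X + ?b *\<^sub>R y) * ?w X) ^ p * norm ((?a *\<^sub>R X + ?b *\<^sub>R y) - X) powr \<alpha>"
        by (rule growth)
      also have "(?a *\<^sub>R X + ?b *\<^sub>R y) - X = (?a - 1) *\<^sub>R X + ?b *\<^sub>R y"
        by (simp add: algebra_simps)
      also have "C * (?w (?a *\<^sub>R X + ?b *\<^sub>R y) * ?w X) ^ p * norm ((?a - 1) *\<^sub>R X + ?b *\<^sub>R y) powr \<alpha> \<le>
         C * ((?w X * ?w y) * ?w X) ^ p * (?c t powr \<alpha> * (?w X * ?w y))"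
        using C_nonneg \<alpha> ab that
        by (intro mult_mono power_mono weight_combination_le norm_combination_powr_le mult_nonneg_nonneg zero_le_power)
           (auto intro!: add_nonneg_nonneg)
      also have "\<dots> = C * ?w X ^ (2 * p + 1) * ?c t powr \<alpha> * ?w y ^ Suc p"
        by (simp only: power_mult_distrib mult_2 mult_2_right power_add power_Suc power_one_right mult_ac)
      finally show "\<bar>h (?a *\<^sub>R X + ?b *\<^sub>R y) - h X\<bar> \<le> C * ?w X ^ (2 * p + 1) * ?c t powr \<alpha> * ?w y ^ Suc p" .
    qed
    also have "\<dots> = K * ?c t powr \<alpha>"
      by (subst integral_mult_right_zero) (simp only: K_def mult_ac)
    finally show ?thesis .
  qed
  have "((\<lambda>t::real. (1 - exp (- t)) + sqrt (1 - exp (- 2 * t))) \<longlongrightarrow> (1 - exp (- 0)) + sqrt (1 - exp (- 2 * 0))) (at_right 0)"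
    by (intro tendsto_intros)
  then have c0: "(?c \<longlongrightarrow> 0) (at_right 0)" by simp
  have "\<forall>\<^sub>F t in at_right 0. (0::real) \<le> t" by (auto simp: eventually_at_right_less eventually_at_filter)
  then have ev: "\<forall>\<^sub>F t in at_right 0. norm (mehler t h X - h X) \<le> K * ?c t powr \<alpha>"
    "\<forall>\<^sub>F t in at_right 0. 0 \<le> ?c t"
    by (eventually_elim, use bound in simp)+
  have "((\<lambda>t. K * ?c t powr \<alpha>) \<longlongrightarrow> K * 0) (at_right 0)"
    using \<alpha> ev(2) by (intro tendsto_mult tendsto_const tendsto_zero_powrI[OF c0]) auto
  then have "((\<lambda>t. mehler t h X - h X) \<longlongrightarrow> 0) (at_right 0)"
    by (intro Lim_null_comparison[OF ev(1)]) simp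
  then show ?thesis by (simp add: LIM_zero_iff)
qed

section \<open>The Stein solution and its generator limit\<close>

definition centred :: "'a \<Rightarrow> real \<Rightarrow> real" where
  "centred X t = mehler t h X - (\<integral>y. h y \<partial>M)"

definition stein :: "'a \<Rightarrow> real" where
  "stein X = - (LBINT t:{0..}. centred X t)"

text \<open>Joint measurability is what Fubini and the measurability of \<open>stein\<close>
  require.\<close>

lemma measurable_centred [measurable]:
  "(\<lambda>(X, t). centred X t) \<in> borel_measurable (borel \<Otimes>\<^sub>M borel)"
proof -
  have "(\<lambda>z. (\<integral>y. h (exp (- snd z) *\<^sub>R fst z + sqrt (1 - exp (- 2 * snd z)) *\<^sub>R y) \<partial>M))
      \<in> borel_measurable (borel \<Otimes>\<^sub>M borel)"
    by measurable
  then show ?thesis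
    by (simp add: centred_def mehler_def case_prod_unfold)
qed

lemma centred_decay: "0 \<le> t \<Longrightarrow> \<bar>centred X t\<bar> \<le> decay_const * weight X ^ Suc p * exp (- \<alpha> * t)"
  unfolding centred_def by (rule mehler_decay)

lemma measurable_centred_time [measurable]: "centred X \<in> borel_measurable borel"
  using measurable_compose[OF measurable_Pair1' measurable_centred, of X] by simp

lemmas centred_integral = exp_decay_integral[OF measurable_centred_time \<alpha>(1) centred_decay]

text \<open>The solution has the growth exponent of h in \<open>h_bound\<close>, so the semigroup
  can be applied to it.\<close>

lemma stein_bound: "\<bar>stein X\<bar> \<le> decay_const / \<alpha> * weight X ^ Suc p"
  using centred_integral(3)[of X] by (simp add: stein_def)

lemma measurable_stein [measurable]: "stein \<in> borel_measurable borel"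
  unfolding stein_def set_lebesgue_integral_def by measurable

lemma integrable_stein_combination:
  "\<bar>a\<bar> \<le> 1 \<Longrightarrow> \<bar>b\<bar> \<le> 1 \<Longrightarrow> integrable M (\<lambda>y. stein (a *\<^sub>R x + b *\<^sub>R y))"
  by (rule integrable_combination[OF measurable_stein stein_bound])

text \<open>Constants are invariant, so centring commutes with the time shift. Subtracting the
  constant under the integral needs integrability, which the decay bound at the fixed time t
  supplies.\<close>

lemma mehler_centred:
  assumes "0 \<le> s" "0 \<le> t"
  shows "mehler s (\<lambda>Y. centred Y t) X = centred X (s + t)"
proof -
  have "integrable M (\<lambda>y. centred (exp (- s) *\<^sub>R X + sqrt (1 - exp (- 2 * s)) *\<^sub>R y) t)"
    by (rule integrable_combination[where f="\<lambda>X. centred X t" and B="decay_const * exp (- \<alpha> * t)" and q="Suc p"])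
       (use centred_decay[OF assms(2)] mehler_coeffs[OF assms(1)] in \<open>auto simp: mult_ac\<close>)
  then have "integrable M (\<lambda>y. centred (exp (- s) *\<^sub>R X + sqrt (1 - exp (- 2 * s)) *\<^sub>R y) t + (\<integral>y. h y \<partial>M))"
    by simp
  then have "integrable M (\<lambda>y. mehler t h (exp (- s) *\<^sub>R X + sqrt (1 - exp (- 2 * s)) *\<^sub>R y))"
    by (simp add: centred_def)
  then show ?thesis
    using mehler_semigroup[OF assms, of X]
    by (simp add: centred_def mehler_def[of s] prob_space)
qed

lemma mehler_stein:
  assumes "0 \<le> s"
  shows "mehler s stein X = - (LBINT t:{s..}. centred X t)"
proof -
  let ?Y = "\<lambda>y. exp (- s) *\<^sub>R X + sqrt (1 - exp (- 2 * s)) *\<^sub>R y"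
  note ab = mehler_coeffs[OF assms]
  interpret L: pair_sigma_finite M lborel ..
  have int: "integrable (M \<Otimes>\<^sub>M lborel) (\<lambda>(y, t). indicator {0..} t *\<^sub>R centred (?Y y) t)"
  proof (rule L.Fubini_integrable)
    show "AE y in M. integrable lborel (\<lambda>t. (\<lambda>(y, t). indicator {0..} t *\<^sub>R centred (?Y y) t) (y, t))"
      using centred_integral(1) by (simp add: set_integrable_def)
    show "integrable M (\<lambda>y. LBINT t. norm ((\<lambda>(y, t). indicator {0..} t *\<^sub>R centred (?Y y) t) (y, t)))"
    proof (rule Bochner_Integration.integrable_bound)
      show "integrable M (\<lambda>y. decay_const / \<alpha> * (weight X * weight y) ^ Suc p)"
        unfolding power_mult_distrib by (intro integrable_mult_right moments)
      show "AE y in M. norm (LBINT t. norm ((\<lambda>(y, t). indicator {0..} t *\<^sub>R centred (?Y y) t) (y, t)))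
          \<le> norm (decay_const / \<alpha> * (weight X * weight y) ^ Suc p)"
      proof (rule AE_I2)
        fix y
        have "norm (LBINT t. norm (indicator {0..} t *\<^sub>R centred (?Y y) t)) =
            (LBINT t. norm (indicator {0..} t *\<^sub>R centred (?Y y) t))"
          by (simp add: integral_nonneg_AE)
        also have "\<dots> \<le> decay_const / \<alpha> * weight (?Y y) ^ Suc p"
          using centred_integral(2)[of "?Y y"] by simp
        also have "\<dots> \<le> decay_const / \<alpha> * (weight X * weight y) ^ Suc p"
          using decay_const_nonneg \<alpha> by (intro mult_left_mono power_mono weight_combination_le ab) auto
        finally show "norm (LBINT t. norm ((\<lambda>(y, t). indicator {0..} t *\<^sub>R centred (?Y y) t) (y, t)))
          \<le> norm (decay_const / \<alpha> * (weight X * weight y) ^ Suc p)"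
          unfolding prod.case by (rule order_trans) (simp only: real_norm_def abs_ge_self)
      qed
    qed measurable
  qed measurable
  have "mehler s stein X = - (\<integral>y. (LBINT t. indicator {0..} t *\<^sub>R centred (?Y y) t) \<partial>M)"
    by (simp add: mehler_def stein_def set_lebesgue_integral_def)
  also have "(\<integral>y. (LBINT t. indicator {0..} t *\<^sub>R centred (?Y y) t) \<partial>M) =
      (LBINT t. (\<integral>y. indicator {0..} t *\<^sub>R centred (?Y y) t \<partial>M))"
    by (rule L.Fubini_integral[symmetric]) (rule int)
  \<comment> \<open>The shape \<open>s + 1 * t\<close> matches the affine substitution applied
    next.\<close>
  also have "\<dots> = (LBINT t. indicator {s..} (s + 1 * t) *\<^sub>R centred X (s + 1 * t))"
  proof (rule Bochner_Integration.integral_cong[OF refl])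
    fix t :: real
    show "(\<integral>y. indicator {0..} t *\<^sub>R centred (?Y y) t \<partial>M) = indicator {s..} (s + 1 * t) *\<^sub>R centred X (s + 1 * t)"
      using mehler_centred[OF assms, of t X] by (simp add: indicator_def mehler_def)
  qed
  also have "\<dots> = (LBINT t. indicator {s..} t *\<^sub>R centred X t)"
    using lborel_integral_real_affine[of 1 "\<lambda>t. indicator {s..} t *\<^sub>R centred X t" s] by simp
  finally show ?thesis by (simp add: set_lebesgue_integral_def)
qed

theorem stein_generator:
  "((\<lambda>s. (mehler s stein X - stein X) / s) \<longlongrightarrow> h X - (\<integral>y. h y \<partial>M)) (at_right 0)"
proof (rule tendstoI)
  let ?l = "h X - (\<integral>y. h y \<partial>M)"
  fix \<epsilon> :: real assume "0 < \<epsilon>"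
  have "((\<lambda>t. centred X t) \<longlongrightarrow> ?l) (at_right 0)"
    unfolding centred_def by (intro tendsto_intros tendsto_mehler_0)
  then have "\<forall>\<^sub>F t in at_right 0. dist (centred X t) ?l < \<epsilon> / 2"
    using \<open>0 < \<epsilon>\<close> by (intro tendstoD) auto
  then obtain \<delta> where \<delta>: "\<delta> > 0" "\<And>t. 0 < t \<Longrightarrow> t < \<delta> \<Longrightarrow> \<bar>centred X t - ?l\<bar> < \<epsilon> / 2"
    by (auto simp: eventually_at_right_field dist_real_def)
  \<comment> \<open>The interval \<open>{0..<s}\<close> contains 0, where the limit says nothing but
    \<open>mehler_0\<close> gives equality. The half of \<epsilon> leaves room for a strict
    inequality after integrating a weak one.\<close>
  have close: "\<bar>centred X t - ?l\<bar> \<le> \<epsilon> / 2" if "0 \<le> t" "t < \<delta>" for t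
    using \<delta>(2)[of t] that \<open>0 < \<epsilon>\<close> mehler_0[of X] by (cases "t = 0") (auto simp: centred_def)
  have "dist ((mehler s stein X - stein X) / s) ?l < \<epsilon>" if s: "0 < s" "s < \<delta>" for s
  proof -
    have i: "set_integrable lborel {0..<s} (centred X)" "set_integrable lborel {s..} (centred X)"
      using s by (auto intro!: set_integrable_subset[OF centred_integral(1)])
    have un: "{0..} = {0..<s} \<union> {s..}" using s by auto
    have "(LBINT t:{0..}. centred X t) = (LBINT t:{0..<s}. centred X t) + (LBINT t:{s..}. centred X t)"
      unfolding un using i by (intro set_integral_Un) auto
    then have "mehler s stein X - stein X = (LBINT t:{0..<s}. centred X t)"
      using s by (simp add: mehler_stein stein_def)
    moreover have c: "set_integrable lborel {0..<s} (\<lambda>_. ?l)" "(LBINT t:{0..<s}. ?l) = s * ?l"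
      using s by (auto simp: set_integrable_def set_lebesgue_integral_def)
    ultimately have "(mehler s stein X - stein X) - s * ?l = (LBINT t:{0..<s}. centred X t - ?l)"
      by (simp only: set_integral_diff(2)[OF i(1) c(1)] c(2))
    moreover have "\<bar>LBINT t:{0..<s}. centred X t - ?l\<bar> \<le> (LBINT t:{0..<s}. \<epsilon> / 2)"
    proof -
      have d: "set_integrable lborel {0..<s} (\<lambda>t. centred X t - ?l)" by (rule set_integral_diff(1)[OF i(1) c(1)])
      have "\<bar>LBINT t:{0..<s}. centred X t - ?l\<bar> \<le> (LBINT t:{0..<s}. \<bar>centred X t - ?l\<bar>)"
        using set_integral_norm_bound[OF d] by simp
      also have "\<dots> \<le> (LBINT t:{0..<s}. \<epsilon> / 2)"
      proof (rule set_integral_mono)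
        show "set_integrable lborel {0..<s} (\<lambda>t. \<bar>centred X t - ?l\<bar>)"
          using d by (rule set_integrable_abs)
        show "set_integrable lborel {0..<s} (\<lambda>_. \<epsilon> / 2)" using s by (simp add: set_integrable_def)
      qed (use close s in auto)
      finally show ?thesis .
    qed
    moreover have "(LBINT t:{0..<s}. \<epsilon> / 2) = s * (\<epsilon> / 2)"
      using s by (simp add: set_lebesgue_integral_def)
    ultimately have "\<bar>(mehler s stein X - stein X) - s * ?l\<bar> \<le> s * (\<epsilon> / 2)" by simp
    also have "\<dots> < s * \<epsilon>" using s \<open>0 < \<epsilon>\<close> by simp
    finally have "\<bar>(mehler s stein X - stein X) - s * ?l\<bar> / s < \<epsilon>" using s by (simp add: divide_less_eq mult.commute)
    moreover have "\<bar>(mehler s stein X - stein X) - s * ?l\<bar> / s = \<bar>(mehler s stein X - stein X) / s - ?l\<bar>"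
      using s by (simp add: diff_divide_distrib abs_divide[symmetric, of _ s, unfolded abs_of_pos[OF s(1)]] del: abs_divide)
    ultimately show ?thesis by (simp add: dist_real_def)
  qed
  then show "\<forall>\<^sub>F s in at_right 0. dist ((mehler s stein X - stein X) / s) ?l < \<epsilon>"
    using \<delta>(1) by (auto simp: eventually_at_right_field)
qed

end

subsection \<open>Growth of the test functions\<close>

lemma hoelder_space_bound:
  assumes "h \<in> hoelder_space \<alpha>"
  shows "\<bar>h X - h Y\<bar> \<le> enn2real (hoelder_seminorm \<alpha> h) * norm (X - Y) powr \<alpha>"
proof (cases "X = Y")
  case False
  have fin: "hoelder_seminorm \<alpha> h < \<infinity>" using assms by (simp add: hoelder_space_def)
  have "ennreal (\<bar>h X - h Y\<bar> / norm (X - Y) powr \<alpha>) \<le> hoelder_seminorm \<alpha> h"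
    unfolding hoelder_seminorm_def frobenius_norm_eq_norm
    by (rule SUP_upper2[of "(X, Y)"]) (use False in auto)
  also have "\<dots> = ennreal (enn2real (hoelder_seminorm \<alpha> h))" using fin by simp
  finally have "\<bar>h X - h Y\<bar> / norm (X - Y) powr \<alpha> \<le> enn2real (hoelder_seminorm \<alpha> h)"
    by (simp add: ennreal_le_iff)
  then show ?thesis using False by (simp add: divide_le_eq)
qed simp

lemma hoelder_seminorm_le:
  assumes "\<And>X Y. \<bar>h X - h Y\<bar> \<le> H * norm (X - Y) powr \<alpha>"
  shows "hoelder_seminorm \<alpha> h \<le> ennreal H"
  unfolding hoelder_seminorm_def frobenius_norm_eq_norm
  by (rule SUP_least) (use assms in \<open>auto intro!: ennreal_leI simp: divide_le_eq\<close>)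

lemma norm_matrix_mono:
  fixes A B :: "real^'d^'n"
  assumes "\<And>i j. \<bar>A $ i $ j\<bar> \<le> \<bar>B $ i $ j\<bar>"
  shows "norm A \<le> norm B"
  unfolding norm_vec_def[of A] norm_vec_def[of B]
  by (intro L2_set_mono norm_le_componentwise_cart) (use assms in auto)

lemma entry_le_norm:
  fixes A :: "real^'d^'n"
  shows "\<bar>A $ i $ j\<bar> \<le> norm A"
  by (rule order_trans[OF component_le_norm_cart Finite_Cartesian_Product.norm_nth_le])

section \<open>From bounds on partial derivatives to increments\<close>

lemma has_partial_at_deriv:
  assumes "has_partial_at p h (Z + t *\<^sub>R unit_matrix p)"
  shows "((\<lambda>t. h (Z + t *\<^sub>R unit_matrix p)) has_field_derivative
    partial_deriv p h (Z + t *\<^sub>R unit_matrix p)) (at t)"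
proof -
  have "((\<lambda>s. h ((Z + t *\<^sub>R unit_matrix p) + s *\<^sub>R unit_matrix p)) has_field_derivative
    partial_deriv p h (Z + t *\<^sub>R unit_matrix p)) (at 0)"
    using assms unfolding has_partial_at_def partial_deriv_def
    by (simp add: DERIV_deriv_iff_real_differentiable)
  then have "((\<lambda>s. h (Z + (s + t) *\<^sub>R unit_matrix p)) has_field_derivative
    partial_deriv p h (Z + t *\<^sub>R unit_matrix p)) (at 0)"
    by (simp add: scaleR_add_left algebra_simps)
  then show ?thesis
    using DERIV_shift[of "\<lambda>t. h (Z + t *\<^sub>R unit_matrix p)" _ 0 t] by simp
qed

text \<open>No continuity of the partial derivatives is known, so move from \<open>Y\<close> to \<open>X\<close> one entry at a time.\<close>

lemma growth_of_partials:
  fixes h :: "real^'d^'n \<Rightarrow> real"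
  assumes diff: "\<And>p X. has_partial_at p h X"
    and bd: "\<And>p X. \<bar>partial_deriv p h X\<bar> \<le> B * weight X ^ m" and "0 \<le> B"
  shows "\<bar>h X - h Y\<bar> \<le> (real CARD('n \<times> 'd) * B) * (weight X * weight Y) ^ m * norm (X - Y)"
proof -
  define Z where "Z S = (\<chi> i j. if (i, j) \<in> S then X $ i $ j else Y $ i $ j)" for S :: "('n \<times> 'd) set"
  let ?K = "B * (weight X * weight Y) ^ m"
  \<comment> \<open>All intermediate matrices, and by convexity the segments between them, lie in
    the ball of radius \<open>norm X + norm Y\<close>. There the weight is at most
    \<open>weight X * weight Y\<close>, so each step has the same bound.\<close>
  have Zn: "norm (Z S) \<le> norm X + norm Y" for S
  proof -
    have "Z S = (\<chi> i j. if (i, j) \<in> S then X $ i $ j else 0) + (\<chi> i j. if (i, j) \<in> S then 0 else Y $ i $ j)"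
      by (simp add: Z_def vec_eq_iff)
    also have "norm \<dots> \<le> norm X + norm Y"
      by (intro norm_triangle_mono norm_matrix_mono) auto
    finally show ?thesis .
  qed
  have "\<bar>h (Z S) - h Y\<bar> \<le> real (card S) * (?K * norm (X - Y))" if "finite S" for S
    using that
  proof (induction S)
    case empty
    have "Z {} = Y" by (simp add: Z_def vec_eq_iff)
    then show ?case by simp
  next
    case (insert q S)
    obtain k l where q: "q = (k, l)" by fastforce
    define d where "d = X $ k $ l - Y $ k $ l"
    have step: "Z (insert q S) = Z S + d *\<^sub>R unit_matrix q"
      using insert(2) by (auto simp: Z_def vec_eq_iff unit_matrix_def q d_def axis_def)
    have "norm (h (Z S + d *\<^sub>R unit_matrix q) - h (Z S + 0 *\<^sub>R unit_matrix q)) \<le> ?K * norm (d - 0)"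
    proof (rule field_differentiable_bound)
      show "convex (closed_segment 0 d)" by simp
      fix t assume t: "t \<in> closed_segment 0 d"
      show "((\<lambda>t. h (Z S + t *\<^sub>R unit_matrix q)) has_field_derivative
        partial_deriv q h (Z S + t *\<^sub>R unit_matrix q)) (at t within closed_segment 0 d)"
        by (rule has_field_derivative_at_within[OF has_partial_at_deriv[OF diff]])
      obtain u where u: "0 \<le> u" "u \<le> 1" "t = u * d"
        using t by (auto simp: closed_segment_def)
      have "Z S + t *\<^sub>R unit_matrix q = (1 - u) *\<^sub>R Z S + u *\<^sub>R Z (insert q S)"
        by (simp add: step u algebra_simps)
      then have "norm (Z S + t *\<^sub>R unit_matrix q) \<le> norm ((1 - u) *\<^sub>R Z S) + norm (u *\<^sub>R Z (insert q S))"
        by (simp only: norm_triangle_ineq)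
      also have "\<dots> = (1 - u) * norm (Z S) + u * norm (Z (insert q S))" using u by simp
      also have "\<dots> \<le> (1 - u) * (norm X + norm Y) + u * (norm X + norm Y)"
        using u by (intro add_mono mult_left_mono Zn) auto
      finally have "norm (Z S + t *\<^sub>R unit_matrix q) \<le> norm X + norm Y" by (simp add: algebra_simps)
      moreover have "0 \<le> norm X * norm Y" by simp
      ultimately have "weight (Z S + t *\<^sub>R unit_matrix q) \<le> weight X * weight Y"
        unfolding ring_distribs by linarith
      then have "B * weight (Z S + t *\<^sub>R unit_matrix q) ^ m \<le> ?K"
        using \<open>0 \<le> B\<close> by (intro mult_left_mono power_mono) auto
      then show "norm (partial_deriv q h (Z S + t *\<^sub>R unit_matrix q)) \<le> ?K"
        using bd[of q "Z S + t *\<^sub>R unit_matrix q"] by simp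
    qed auto
    also have "?K * norm (d - 0) \<le> ?K * norm (X - Y)"
      using \<open>0 \<le> B\<close> entry_le_norm[of "X - Y" k l] by (intro mult_left_mono) (auto simp: d_def)
    finally have "\<bar>h (Z (insert q S)) - h (Z S)\<bar> \<le> ?K * norm (X - Y)"
      by (simp add: step)
    then have "\<bar>h (Z (insert q S)) - h Y\<bar> \<le> ?K * norm (X - Y) + real (card S) * (?K * norm (X - Y))"
      using insert(3) by linarith
    also have "\<dots> = real (card (insert q S)) * (?K * norm (X - Y))"
      using insert(1,2) by (simp add: algebra_simps)
    finally show ?case .
  qed
  from this[of UNIV] show ?thesis
    by (simp add: Z_def mult_ac)
qed

text \<open>The head of the list is the derivative taken last, whereas induction on the order must
  peel off the one taken first.\<close>

lemma iterated_partial_snoc: "iterated_partial (ps @ [q]) h = iterated_partial ps (partial_deriv q h)"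
  by (induction ps) auto

lemma Lip_class_Suc_partial:
  fixes h :: "real^'d^'n \<Rightarrow> real"
  assumes "h \<in> Lip_class (Suc k)"
  shows "partial_deriv q h \<in> Lip_class k" "has_partial_at q h X"
proof -
  have 1: "has_partial_at p (iterated_partial ps h) X" if "length ps < Suc k" for ps p X
    using assms that unfolding Lip_class_def by blast
  have 2: "iterated_partial ps h \<in> hoelder_space 1" if "length ps = Suc k" for ps
    using assms that unfolding Lip_class_def by blast
  show "has_partial_at q h X" using 1[of "[]"] by simp
  show "partial_deriv q h \<in> Lip_class k"
    unfolding Lip_class_def mem_Collect_eq
  proof (intro conjI allI impI)
    fix ps :: "('n \<times> 'd) list" and p X assume "length ps < k"
    then show "has_partial_at p (iterated_partial ps (partial_deriv q h)) X"
      using 1[of "ps @ [q]"] by (simp add: iterated_partial_snoc)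
  next
    fix ps :: "('n \<times> 'd) list" assume "length ps = k"
    then show "iterated_partial ps (partial_deriv q h) \<in> hoelder_space 1"
      using 2[of "ps @ [q]"] by (simp add: iterated_partial_snoc)
  qed
qed

text \<open>By induction each first partial has increments of polynomial growth; comparing with its
  value at 0 costs one more weight and gives the bound that \<open>growth_of_partials\<close> asks
  for.\<close>

lemma Lip_class_growth:
  fixes h :: "real^'d^'n \<Rightarrow> real"
  assumes "h \<in> Lip_class k"
  shows "\<exists>C m. \<forall>X Y. \<bar>h X - h Y\<bar> \<le> C * (weight X * weight Y) ^ m * norm (X - Y)"
  using assms
proof (induction k arbitrary: h)
  case 0
  then have "iterated_partial [] h \<in> hoelder_space 1" unfolding Lip_class_def by blast
  then have "h \<in> hoelder_space 1" by simp
  from hoelder_space_bound[OF this] show ?case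
    by (intro exI[of _ "enn2real (hoelder_seminorm 1 h)"] exI[of _ 0]) simp
next
  case (Suc k)
  have "\<exists>B m. 0 \<le> B \<and> (\<forall>X. \<bar>partial_deriv q h X\<bar> \<le> B * weight X ^ m)" for q
  proof -
    from Suc.IH[OF Lip_class_Suc_partial(1)[OF Suc.prems]] obtain C m
      where C: "\<And>X Y. \<bar>partial_deriv q h X - partial_deriv q h Y\<bar> \<le> C * (weight X * weight Y) ^ m * norm (X - Y)"
      by blast
    let ?c = "\<bar>partial_deriv q h 0\<bar>"
    have "\<bar>partial_deriv q h X\<bar> \<le> (?c + \<bar>C\<bar>) * weight X ^ Suc m" for X
    proof -
      have "\<bar>partial_deriv q h X - partial_deriv q h 0\<bar> \<le> C * weight X ^ m * norm X"
        using C[of X 0] by simp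
      also have "\<dots> \<le> \<bar>C\<bar> * weight X ^ m * weight X"
        by (intro mult_mono) auto
      finally have 1: "\<bar>partial_deriv q h X - partial_deriv q h 0\<bar> \<le> \<bar>C\<bar> * weight X ^ Suc m"
        by (simp add: mult_ac)
      have "?c * 1 \<le> ?c * weight X ^ Suc m"
        by (intro mult_left_mono one_le_power) auto
      with 1 show ?thesis unfolding distrib_right by linarith
    qed
    then show ?thesis by (intro exI[of _ "?c + \<bar>C\<bar>"] exI[of _ "Suc m"]) auto
  qed
  then obtain B m where Bm: "\<And>q. 0 \<le> B q" "\<And>q X. \<bar>partial_deriv q h X\<bar> \<le> B q * weight X ^ m q"
    by metis
  \<comment> \<open>Sums over the finitely many directions dominate every single constant and, as
    weights are at least one, every single exponent.\<close>
  have "\<bar>partial_deriv q h X\<bar> \<le> (\<Sum>q\<in>UNIV. B q) * weight X ^ (\<Sum>q\<in>UNIV. m q)" for q X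
  proof -
    have "B q * weight X ^ m q \<le> (\<Sum>q\<in>UNIV. B q) * weight X ^ (\<Sum>q\<in>UNIV. m q)"
      using Bm(1) by (intro mult_mono power_increasing member_le_sum sum_nonneg) auto
    with Bm(2)[of q X] show ?thesis by linarith
  qed
  from growth_of_partials[OF Lip_class_Suc_partial(2)[OF Suc.prems] this sum_nonneg[OF Bm(1)]]
  show ?case by blast
qed

subsection \<open>The Hoelder--Kantorovich bound\<close>

text \<open>After division by x + y both terms lie in [0, 1], where u \<le>
  \<open>u powr a\<close>.\<close>

lemma powr_add_le:
  fixes x y :: real
  assumes "0 \<le> x" "0 \<le> y" "0 < a" "a \<le> 1"
  shows "(x + y) powr a \<le> x powr a + y powr a"
proof (cases "x + y = 0")
  case False
  then have s: "x + y > 0" using assms by simp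
  have *: "u / (x + y) \<le> (u / (x + y)) powr a" if "0 \<le> u" "u \<le> x + y" for u
  proof (cases "u = 0")
    case False
    then have "(u / (x + y)) powr 1 \<le> (u / (x + y)) powr a"
      using that s assms by (intro powr_mono') auto
    then show ?thesis using that s False by simp
  qed simp
  have "1 = x / (x + y) + y / (x + y)" using s by (simp add: add_divide_distrib[symmetric])
  also have "\<dots> \<le> (x / (x + y)) powr a + (y / (x + y)) powr a"
    using assms by (intro add_mono *) auto
  also have "\<dots> = (x powr a + y powr a) / (x + y) powr a"
    using assms by (simp add: powr_divide add_divide_distrib)
  finally show ?thesis using s by (simp add: le_divide_eq)
qed (use assms in auto)

lemma mehler_test_hoelder:
  fixes h :: "real^'d^'n \<Rightarrow> real"
  assumes "mehler_law M" "h \<in> hoelder_space \<alpha>" "0 < \<alpha>" "\<alpha> \<le> 1"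
  shows "mehler_test M h (enn2real (hoelder_seminorm \<alpha> h)) \<alpha> 0"
proof -
  interpret mehler_law M by fact
  show ?thesis
    by unfold_locales (use assms(3,4) hoelder_space_bound[OF assms(2)] in auto)
qed

lemma mehler_test_Lip_class:
  fixes h :: "real^'d^'n \<Rightarrow> real"
  assumes "mehler_law M" "h \<in> Lip_class k"
  shows "\<exists>C m. mehler_test M h C 1 m"
proof -
  interpret mehler_law M by fact
  obtain C m where "\<And>X Y. \<bar>h X - h Y\<bar> \<le> C * (weight X * weight Y) ^ m * norm (X - Y)"
    using Lip_class_growth[OF assms(2)] by blast
  then have "mehler_test M h C 1 m" by unfold_locales auto
  then show ?thesis by blast
qed

lemma hoelder_kantorovich_dist_le:
  fixes M :: "(real^'d^'n) measure"
  assumes M: "mehler_law M" and \<alpha>: "0 < \<alpha>" "\<alpha> \<le> 1"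
  shows "hoelder_kantorovich_dist \<alpha> (return borel X) M
    \<le> ennreal ((\<integral>Y. norm Y powr \<alpha> \<partial>M) + norm X powr \<alpha>)"
  unfolding hoelder_kantorovich_dist_def
proof (rule SUP_least)
  interpret mehler_law M by fact
  fix g :: "real^'d^'n \<Rightarrow> real" assume "g \<in> {g \<in> hoelder_space \<alpha>. hoelder_seminorm \<alpha> g \<le> 1}"
  then have g: "g \<in> hoelder_space \<alpha>" "hoelder_seminorm \<alpha> g \<le> 1" by auto
  interpret T: mehler_test M g "enn2real (hoelder_seminorm \<alpha> g)" \<alpha> 0
    by (rule mehler_test_hoelder[OF M g(1) \<alpha>])
  have "enn2real (hoelder_seminorm \<alpha> g) \<le> 1"
    using enn2real_mono[OF g(2)] by simp
  then have gl: "\<bar>g X - g Y\<bar> \<le> norm (X - Y) powr \<alpha>" for X Y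
    using hoelder_space_bound[OF g(1), of X Y] mult_right_mono[of _ 1 "norm (X - Y) powr \<alpha>"]
    by fastforce
  have pow: "integrable M (\<lambda>Y. norm Y powr \<alpha>)"
  proof (rule Bochner_Integration.integrable_bound)
    show "integrable M (\<lambda>Y. weight Y ^ 1)" by (rule moments)
    show "AE Y in M. norm (norm Y powr \<alpha>) \<le> norm (weight Y ^ 1)"
      using powr_le_add_one \<alpha> by (intro AE_I2) auto
  qed measurable
  have "\<bar>g X - (\<integral>Y. g Y \<partial>M)\<bar> = \<bar>\<integral>Y. g X - g Y \<partial>M\<bar>"
    by (subst Bochner_Integration.integral_diff) (use T.integrable_h in auto)
  also have "\<dots> \<le> (\<integral>Y. \<bar>g X - g Y\<bar> \<partial>M)" by (rule integral_abs_bound)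
  also have "\<dots> \<le> (\<integral>Y. norm Y powr \<alpha> + norm X powr \<alpha> \<partial>M)"
  proof (rule integral_mono)
    show "integrable M (\<lambda>Y. \<bar>g X - g Y\<bar>)" using T.integrable_h by auto
    show "integrable M (\<lambda>Y. norm Y powr \<alpha> + norm X powr \<alpha>)" using pow by auto
    fix Y
    have "norm (X - Y) powr \<alpha> \<le> (norm X + norm Y) powr \<alpha>"
      using \<alpha> norm_triangle_ineq4[of X Y] by (intro powr_mono2) auto
    also have "\<dots> \<le> norm X powr \<alpha> + norm Y powr \<alpha>" using \<alpha> by (intro powr_add_le) auto
    finally show "\<bar>g X - g Y\<bar> \<le> norm Y powr \<alpha> + norm X powr \<alpha>" using gl[of X Y] by simp
  qed
  also have "\<dots> = (\<integral>Y. norm Y powr \<alpha> \<partial>M) + norm X powr \<alpha>" using pow by simp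
  finally show "ennreal \<bar>(\<integral>Y. g Y \<partial>return borel X) - (\<integral>Y. g Y \<partial>M)\<bar>
      \<le> ennreal ((\<integral>Y. norm Y powr \<alpha> \<partial>M) + norm X powr \<alpha>)"
    by (subst integral_return) (auto simp del: ennreal_plus intro!: ennreal_leI)
qed

text \<open>\<open>enn2real\<close> sends infinity to 0, so real-valued estimates by the distance
  rest on this.\<close>

lemma hoelder_kantorovich_dist_finite:
  assumes "mehler_law M" "0 < \<alpha>" "\<alpha> \<le> 1"
  shows "hoelder_kantorovich_dist \<alpha> (return borel X) M < \<infinity>"
  using hoelder_kantorovich_dist_le[OF assms, of X] ennreal_less_top
  unfolding infinity_ennreal_def by (rule order_le_less_trans)

text \<open>For c > 0 the function g / c competes in the supremum; for c = 0 the function g is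
  constant.\<close>

lemma hoelder_kantorovich_dist_dominates:
  fixes M :: "(real^'d^'n) measure"
  assumes M: "mehler_law M" and \<alpha>: "0 < \<alpha>" "\<alpha> \<le> 1"
    and g: "\<And>X Y. \<bar>g X - g Y\<bar> \<le> c * norm (X - Y) powr \<alpha>" and "0 \<le> c"
  shows "\<bar>g X - (\<integral>Y. g Y \<partial>M)\<bar> \<le> c * enn2real (hoelder_kantorovich_dist \<alpha> (return borel X) M)"
proof -
  interpret mehler_law M by fact
  have fin: "hoelder_kantorovich_dist \<alpha> (return borel X) M \<noteq> \<infinity>"
    using hoelder_kantorovich_dist_finite[OF M \<alpha>, of X] by simp
  show ?thesis
  proof (cases "c = 0")
    case True
    then have eq: "g Y = g X" for Y using g[of Y X] by simp
    have "(\<integral>Y. g Y \<partial>M) = (\<integral>Y. g X \<partial>M)"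
      by (rule Bochner_Integration.integral_cong[OF refl eq])
    then show ?thesis using True by simp
  next
    case False
    then have "0 < c" using \<open>0 \<le> c\<close> by simp
    define f where "f Y = g Y / c" for Y
    have "\<bar>f X - f Y\<bar> \<le> 1 * norm (X - Y) powr \<alpha>" for X Y
      using g[of X Y] \<open>0 < c\<close>
      by (simp add: f_def diff_divide_distrib[symmetric] divide_le_eq mult.commute)
    then have s: "hoelder_seminorm \<alpha> f \<le> ennreal 1" by (rule hoelder_seminorm_le)
    then have f: "f \<in> hoelder_space \<alpha>" unfolding hoelder_space_def
      by (simp add: order_le_less_trans[of _ 1])
    interpret T: mehler_test M f "enn2real (hoelder_seminorm \<alpha> f)" \<alpha> 0
      by (rule mehler_test_hoelder[OF M f \<alpha>])
    have "ennreal \<bar>(\<integral>Y. f Y \<partial>return borel X) - (\<integral>Y. f Y \<partial>M)\<bar>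
        \<le> hoelder_kantorovich_dist \<alpha> (return borel X) M"
      unfolding hoelder_kantorovich_dist_def by (rule SUP_upper) (use f s in auto)
    also have "\<dots> = ennreal (enn2real (hoelder_kantorovich_dist \<alpha> (return borel X) M))"
      using fin by (simp add: less_top)
    finally have "\<bar>f X - (\<integral>Y. f Y \<partial>M)\<bar> \<le> enn2real (hoelder_kantorovich_dist \<alpha> (return borel X) M)"
      by (subst (asm) integral_return) (auto simp: ennreal_le_iff)
    moreover have "\<bar>f X - (\<integral>Y. f Y \<partial>M)\<bar> = \<bar>g X - (\<integral>Y. g Y \<partial>M)\<bar> / c"
      using \<open>0 < c\<close> by (simp add: f_def diff_divide_distrib[symmetric])
    ultimately show ?thesis using \<open>0 < c\<close> by (simp add: divide_le_eq mult.commute)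
  qed
qed

text \<open>\<open>Z \<mapsto> P\<^sub>t h Z\<close> has Hoelder constant \<open>exp (- \<alpha> * t) * [h]\<close>, which gives the decay rate.\<close>

lemma stein_hoelder_bound:
  fixes h :: "real^'d^'n \<Rightarrow> real"
  assumes M: "mehler_law M" and h: "h \<in> hoelder_space \<alpha>" and \<alpha>: "0 < \<alpha>" "\<alpha> \<le> 1"
  shows "\<bar>mehler_test.stein M h X\<bar> \<le> 1 / \<alpha> * enn2real (hoelder_seminorm \<alpha> h)
     * enn2real (hoelder_kantorovich_dist \<alpha> (return borel X) M)"
proof -
  let ?H = "enn2real (hoelder_seminorm \<alpha> h)"
  let ?D = "enn2real (hoelder_kantorovich_dist \<alpha> (return borel X) M)"
  interpret mehler_test M h ?H \<alpha> 0 by (rule mehler_test_hoelder[OF M h \<alpha>])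
  have decay: "\<bar>centred X t\<bar> \<le> ?H * ?D * exp (- \<alpha> * t)" if t: "0 \<le> t" for t
  proof -
    let ?a = "exp (- t)" and ?b = "sqrt (1 - exp (- 2 * t))"
    note ab = mehler_coeffs[OF t]
    have lip: "\<bar>mehler t h Z - mehler t h W\<bar> \<le> (exp (- \<alpha> * t) * ?H) * norm (Z - W) powr \<alpha>" for Z W
    proof -
      have "\<bar>mehler t h Z - mehler t h W\<bar> = \<bar>\<integral>Y. h (?a *\<^sub>R Z + ?b *\<^sub>R Y) - h (?a *\<^sub>R W + ?b *\<^sub>R Y) \<partial>M\<bar>"
        unfolding mehler_def
        by (subst Bochner_Integration.integral_diff[OF integrable_h_combination[OF ab(1,2)] integrable_h_combination[OF ab(1,2)]]) simp
      also have "\<dots> \<le> (\<integral>Y. \<bar>h (?a *\<^sub>R Z + ?b *\<^sub>R Y) - h (?a *\<^sub>R W + ?b *\<^sub>R Y)\<bar> \<partial>M)"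
        by (rule integral_abs_bound)
      also have "\<dots> \<le> (\<integral>Y. (exp (- \<alpha> * t) * ?H) * norm (Z - W) powr \<alpha> \<partial>M)"
      proof (rule integral_mono)
        show "integrable M (\<lambda>Y. \<bar>h (?a *\<^sub>R Z + ?b *\<^sub>R Y) - h (?a *\<^sub>R W + ?b *\<^sub>R Y)\<bar>)"
          by (intro integrable_abs Bochner_Integration.integrable_diff integrable_h_combination ab)
        fix Y
        have eq: "(?a *\<^sub>R Z + ?b *\<^sub>R Y) - (?a *\<^sub>R W + ?b *\<^sub>R Y) = ?a *\<^sub>R (Z - W)"
          by (simp add: algebra_simps)
        have "(exp (- t) * norm (Z - W)) powr \<alpha> = exp (- \<alpha> * t) * norm (Z - W) powr \<alpha>"
          by (simp add: powr_mult) (simp add: powr_def)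
        then show "\<bar>h (?a *\<^sub>R Z + ?b *\<^sub>R Y) - h (?a *\<^sub>R W + ?b *\<^sub>R Y)\<bar> \<le> (exp (- \<alpha> * t) * ?H) * norm (Z - W) powr \<alpha>"
          using hoelder_space_bound[OF h, of "?a *\<^sub>R Z + ?b *\<^sub>R Y" "?a *\<^sub>R W + ?b *\<^sub>R Y"]
          unfolding eq by (simp add: mult_ac)
      qed simp
      finally show ?thesis by simp
    qed
    \<comment> \<open>M is invariant, so \<open>centred X t\<close> compares the integrals of the
      single function \<open>mehler t h\<close> against the point mass and M, which is what the
      distance controls.\<close>
    have "(\<integral>Y. mehler t h Y \<partial>M) = (\<integral>y. h y \<partial>M)"
      using pair.integral_fst'[OF stationary_eq_pair(2)[OF t]] stationary_eq_pair(1)[OF t]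
      by (simp add: mehler_def)
    then show ?thesis
      using hoelder_kantorovich_dist_dominates[OF M \<alpha> lip, of X]
      by (simp add: centred_def mult_ac)
  qed
  show ?thesis
    using exp_decay_integral(3)[OF measurable_centred_time \<alpha>(1) decay]
    by (simp add: stein_def mult_ac)
qed

subsection \<open>The matrix normal law is a Mehler law\<close>

lemma mehler_law_distr_std_gauss:
  fixes L :: "'b::euclidean_space \<Rightarrow> 'a::euclidean_space"
  assumes "linear L"
  shows "mehler_law (distr std_gauss borel L)"
proof -
  note [measurable] = borel_measurable_linear[OF assms]
  interpret G: prob_space "std_gauss :: 'b measure" by (rule prob_space_std_gauss)
  interpret D: prob_space "distr std_gauss borel L" by (rule G.prob_space_distr) simp
  show ?thesis
  proof
    show "sets (distr std_gauss borel L) = sets borel" by simp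
    fix q :: nat
    obtain B where B: "B > 0" "\<And>x. norm (L x) \<le> B * norm x"
      using linear_bounded_pos[OF assms] by blast
    have "integrable std_gauss (\<lambda>x. weight (L x) ^ q)"
    proof (rule Bochner_Integration.integrable_bound)
      show "integrable std_gauss (\<lambda>x::'b. (1 + B) ^ q * (1 + norm x) ^ q)"
        by (intro integrable_mult_right std_gauss_moment)
      have "weight (L x) ^ q \<le> (1 + B) ^ q * (1 + norm x) ^ q" for x
      proof -
        have "weight (L x) \<le> 1 + B * norm x" using B(2) by simp
        also have "\<dots> \<le> (1 + B) * (1 + norm x)" using B(1) by (simp add: algebra_simps)
        finally show ?thesis unfolding power_mult_distrib[symmetric] by (rule power_mono) simp
      qed
      then show "AE x in std_gauss. norm (weight (L x) ^ q) \<le> norm ((1 + B) ^ q * (1 + norm x) ^ q)"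
        using B(1) by (intro AE_I2) (simp add: abs_mult)
    qed simp
    then show "integrable (distr std_gauss borel L) (\<lambda>x. weight x ^ q)"
      by (subst integrable_distr_eq) auto
  next
    fix a b :: real assume ab: "a\<^sup>2 + b\<^sup>2 = 1"
    have "distr std_gauss borel L \<Otimes>\<^sub>M distr std_gauss borel L =
       distr (std_gauss \<Otimes>\<^sub>M std_gauss) (borel \<Otimes>\<^sub>M borel) (\<lambda>(x, y). (L x, L y))"
      by (rule pair_measure_distr) (auto intro: D.sigma_finite_measure_axioms)
    then have "distr (distr std_gauss borel L \<Otimes>\<^sub>M distr std_gauss borel L) borel (\<lambda>(x, y). a *\<^sub>R x + b *\<^sub>R y) =
       distr (std_gauss \<Otimes>\<^sub>M std_gauss) borel ((\<lambda>(x, y). a *\<^sub>R x + b *\<^sub>R y) \<circ> (\<lambda>(x, y). (L x, L y)))"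
      by (simp only:) (rule distr_distr, measurable)
    \<comment> \<open>L commutes with the combination, so stability passes from the standard
      Gaussian to its image.\<close>
    also have "(\<lambda>(x, y). a *\<^sub>R x + b *\<^sub>R y) \<circ> (\<lambda>(x, y). (L x, L y)) = L \<circ> (\<lambda>(x, y). a *\<^sub>R x + b *\<^sub>R y)"
      by (auto simp: linear_add[OF assms] linear_scale[OF assms])
    also have "distr (std_gauss \<Otimes>\<^sub>M std_gauss) borel (L \<circ> (\<lambda>(x, y). a *\<^sub>R x + b *\<^sub>R y)) =
       distr (distr (std_gauss \<Otimes>\<^sub>M std_gauss) borel (\<lambda>(x, y). a *\<^sub>R x + b *\<^sub>R y)) borel L"
      by (rule distr_distr[symmetric]) measurable
    finally show "distr (distr std_gauss borel L \<Otimes>\<^sub>M distr std_gauss borel L) borel (\<lambda>(x, y). a *\<^sub>R x + b *\<^sub>R y) =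
       distr std_gauss borel L"
      by (simp only: std_gauss_stable[OF ab])
  qed
qed

lemma mehler_law_matrix_normal:
  fixes \<Psi> :: "real^'n^'n" and \<Sigma> :: "real^'d^'d"
  assumes "sym_pos_def \<Psi>" and "sym_pos_def \<Sigma>"
  shows "mehler_law (ou_stationary \<Psi> \<Sigma>)"
proof -
  have "linear (\<lambda>v. sym_sqrt \<Psi> ** unvec_transpose v ** sym_sqrt \<Sigma>)"
    using linear_compose[of unvec_transpose, OF _ linear_sandwich[of "sym_sqrt \<Psi>" "sym_sqrt \<Sigma>"]]
    by (auto simp: o_def unvec_transpose_def linear_iff vec_eq_iff)
  then show ?thesis
    unfolding matrix_normal_eq_distr[OF assms] by (rule mehler_law_distr_std_gauss)
qed

section \<open>Transfer to the matrix Ornstein-Uhlenbeck semigroup\<close>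

lemma ou_semigroup_integrand:
  fixes \<Psi> :: "real^'n^'n" and \<Sigma> :: "real^'d^'d" and f :: "real^'d^'n \<Rightarrow> real"
  assumes "sym_pos_def \<Psi>" and "sym_pos_def \<Sigma>" and [measurable]: "f \<in> borel_measurable borel"
  shows "ou_semigroup \<Psi> \<Sigma> t f X =
      (\<integral>Y. f (exp (- t) *\<^sub>R X + sqrt (1 - exp (- 2 * t)) *\<^sub>R Y) \<partial>ou_stationary \<Psi> \<Sigma>)"
    "integrable std_matrix_normal (\<lambda>Z. f (ou_state \<Psi> \<Sigma> t X Z)) \<longleftrightarrow>
      integrable (ou_stationary \<Psi> \<Sigma>) (\<lambda>Y. f (exp (- t) *\<^sub>R X + sqrt (1 - exp (- 2 * t)) *\<^sub>R Y))"
proof -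
  have m: "(\<lambda>Z. sym_sqrt \<Psi> ** Z ** sym_sqrt \<Sigma>) \<in> (std_matrix_normal :: (real^'d^'n) measure) \<rightarrow>\<^sub>M borel"
    using borel_measurable_linear[OF linear_sandwich]
    by (simp add: matrix_normal_def)
  show "ou_semigroup \<Psi> \<Sigma> t f X =
      (\<integral>Y. f (exp (- t) *\<^sub>R X + sqrt (1 - exp (- 2 * t)) *\<^sub>R Y) \<partial>ou_stationary \<Psi> \<Sigma>)"
    unfolding distr_std_matrix_normal[OF assms(1,2), symmetric] ou_semigroup_def ou_state_def
    by (subst integral_distr[OF m]) simp_all
  \<comment> \<open>Integrals of non-integrable functions are 0 by convention, so equality of
    integrals does not show that the expectations exist; this equivalence carries their existence
    over.\<close>
  show "integrable std_matrix_normal (\<lambda>Z. f (ou_state \<Psi> \<Sigma> t X Z)) \<longleftrightarrow>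
      integrable (ou_stationary \<Psi> \<Sigma>) (\<lambda>Y. f (exp (- t) *\<^sub>R X + sqrt (1 - exp (- 2 * t)) *\<^sub>R Y))"
    unfolding distr_std_matrix_normal[OF assms(1,2), symmetric] ou_state_def
    by (subst integrable_distr_eq[OF m]) simp_all
qed

lemma stein_solution_eq:
  fixes \<Psi> :: "real^'n^'n" and \<Sigma> :: "real^'d^'d" and h :: "real^'d^'n \<Rightarrow> real"
  assumes "sym_pos_def \<Psi>" "sym_pos_def \<Sigma>" "mehler_test (ou_stationary \<Psi> \<Sigma>) h C \<alpha> p"
  shows "stein_solution \<Psi> \<Sigma> h = mehler_test.stein (ou_stationary \<Psi> \<Sigma>) h"
    "ou_semigroup \<Psi> \<Sigma> t h X = mehler_law.mehler (ou_stationary \<Psi> \<Sigma>) t h X"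
proof -
  interpret mehler_test "ou_stationary \<Psi> \<Sigma>" h C \<alpha> p by fact
  show *: "ou_semigroup \<Psi> \<Sigma> t h X = mehler t h X" for t X
    by (simp add: ou_semigroup_integrand[OF assms(1,2)] mehler_def)
  show "stein_solution \<Psi> \<Sigma> h = stein"
    by (simp add: fun_eq_iff stein_solution_def stein_def centred_def *)
qed

theorem theorem1:
  fixes \<Psi> :: "real^'n^'n" and \<Sigma> :: "real^'d^'d" and h :: "real^'d^'n \<Rightarrow> real"
  assumes "sym_pos_def \<Psi>" and "sym_pos_def \<Sigma>"
    and "(\<exists>\<alpha>. 0 < \<alpha> \<and> \<alpha> \<le> 1 \<and> h \<in> hoelder_space \<alpha>) \<or> (\<exists>p. h \<in> Lip_class p)"
  shows
    "integrable (ou_stationary \<Psi> \<Sigma>) h \<and>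
     (\<forall>X. \<forall>t\<ge>0. integrable std_matrix_normal (\<lambda>Z. h (ou_state \<Psi> \<Sigma> t X Z))) \<and>
     (\<forall>X. set_integrable lborel {0..}
        (\<lambda>t. ou_semigroup \<Psi> \<Sigma> t h X - (\<integral>Y. h Y \<partial>ou_stationary \<Psi> \<Sigma>))) \<and>
     (\<forall>X. \<forall>s\<ge>0. integrable std_matrix_normal
        (\<lambda>Z. stein_solution \<Psi> \<Sigma> h (ou_state \<Psi> \<Sigma> s X Z))) \<and>
     (\<forall>X. ((\<lambda>s. (ou_semigroup \<Psi> \<Sigma> s (stein_solution \<Psi> \<Sigma> h) X - stein_solution \<Psi> \<Sigma> h X) / s)
        \<longlongrightarrow> h X - (\<integral>Y. h Y \<partial>ou_stationary \<Psi> \<Sigma>)) (at_right 0)) \<and>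
     (\<forall>\<alpha>. 0 < \<alpha> \<longrightarrow> \<alpha> \<le> 1 \<longrightarrow> h \<in> hoelder_space \<alpha> \<longrightarrow>
        (\<forall>X. ennreal \<bar>stein_solution \<Psi> \<Sigma> h X\<bar>
               \<le> ennreal (1 / \<alpha>) * hoelder_seminorm \<alpha> h
                  * hoelder_kantorovich_dist \<alpha> (return borel X) (ou_stationary \<Psi> \<Sigma>)
           \<and> ennreal (1 / \<alpha>) * hoelder_seminorm \<alpha> h
                  * hoelder_kantorovich_dist \<alpha> (return borel X) (ou_stationary \<Psi> \<Sigma>)
               \<le> ennreal (1 / \<alpha>) * hoelder_seminorm \<alpha> h
                  * ennreal ((\<integral>Y. frobenius_norm Y powr \<alpha> \<partial>ou_stationary \<Psi> \<Sigma>)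
                      + frobenius_norm X powr \<alpha>)))"
proof -
  let ?\<gamma> = "ou_stationary \<Psi> \<Sigma>"
  note pd = assms(1,2)
  have law: "mehler_law ?\<gamma>" by (rule mehler_law_matrix_normal[OF pd])
  have "\<exists>C \<alpha> p. mehler_test ?\<gamma> h C \<alpha> p"
    using assms(3)
  proof
    assume "\<exists>\<alpha>. 0 < \<alpha> \<and> \<alpha> \<le> 1 \<and> h \<in> hoelder_space \<alpha>"
    then show ?thesis using mehler_test_hoelder[OF law] by blast
  next
    assume "\<exists>p. h \<in> Lip_class p"
    then show ?thesis using mehler_test_Lip_class[OF law] by blast
  qed
  then obtain C \<beta> p where test: "mehler_test ?\<gamma> h C \<beta> p" by blast
  interpret mehler_test ?\<gamma> h C \<beta> p by (rule test)
  have sg: "ou_semigroup \<Psi> \<Sigma> t h X - (\<integral>Y. h Y \<partial>?\<gamma>) = centred X t" for t X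
    by (simp add: stein_solution_eq(2)[OF pd test] centred_def)
  have st: "stein_solution \<Psi> \<Sigma> h = stein" by (rule stein_solution_eq(1)[OF pd test])
  have mh: "ou_semigroup \<Psi> \<Sigma> s stein X = mehler s stein X" for s X
    by (simp add: ou_semigroup_integrand(1)[OF pd] mehler_def)
  have 1: "integrable std_matrix_normal (\<lambda>Z. h (ou_state \<Psi> \<Sigma> t X Z))" if "0 \<le> t" for t X
    unfolding ou_semigroup_integrand(2)[OF pd borel_measurable_h]
    by (rule integrable_h_combination[OF mehler_coeffs(1,2)[OF that]])
  have 2: "integrable std_matrix_normal (\<lambda>Z. stein (ou_state \<Psi> \<Sigma> s X Z))" if "0 \<le> s" for s X
    unfolding ou_semigroup_integrand(2)[OF pd measurable_stein]
    by (rule integrable_stein_combination[OF mehler_coeffs(1,2)[OF that]])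
  \<comment> \<open>\<alpha> ranges over all Hoelder exponents of h and may differ from the \<beta>
    of the interpretation. \<open>stein\<close> depends only on the law and h, so
    \<open>stein_hoelder_bound\<close> at \<alpha> speaks of the same function.\<close>
  have 3: "ennreal \<bar>stein X\<bar> \<le> ennreal (1 / \<alpha>) * hoelder_seminorm \<alpha> h
                  * hoelder_kantorovich_dist \<alpha> (return borel X) ?\<gamma>"
    if \<alpha>: "0 < \<alpha>" "\<alpha> \<le> 1" and h: "h \<in> hoelder_space \<alpha>" for \<alpha> X
  proof -
    let ?H = "hoelder_seminorm \<alpha> h" and ?D = "hoelder_kantorovich_dist \<alpha> (return borel X) ?\<gamma>"
    have fin: "?H < \<infinity>" "?D < \<infinity>"
      using h hoelder_kantorovich_dist_finite[OF law \<alpha>, of X] by (auto simp: hoelder_space_def)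
    have mult: "ennreal (1 / \<alpha> * a * b) = ennreal (1 / \<alpha>) * ennreal a * ennreal b"
      if "0 \<le> a" "0 \<le> b" for a b
      using that \<alpha> by (simp only: ennreal_mult mult_nonneg_nonneg zero_le_divide_1_iff less_imp_le)
    have "ennreal \<bar>stein X\<bar> \<le> ennreal (1 / \<alpha> * enn2real ?H * enn2real ?D)"
      using stein_hoelder_bound[OF law h \<alpha>, of X] by (rule ennreal_leI)
    also have "\<dots> = ennreal (1 / \<alpha>) * ?H * ?D"
      unfolding mult[OF enn2real_nonneg enn2real_nonneg]
      by (simp only: ennreal_enn2real fin[unfolded infinity_ennreal_def])
    finally show ?thesis .
  qed
  have 4: "ennreal (1 / \<alpha>) * hoelder_seminorm \<alpha> h * hoelder_kantorovich_dist \<alpha> (return borel X) ?\<gamma>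
      \<le> ennreal (1 / \<alpha>) * hoelder_seminorm \<alpha> h
          * ennreal ((\<integral>Y. frobenius_norm Y powr \<alpha> \<partial>?\<gamma>) + frobenius_norm X powr \<alpha>)"
    if "0 < \<alpha>" "\<alpha> \<le> 1" for \<alpha> X
    unfolding frobenius_norm_eq_norm
    by (rule mult_left_mono[OF hoelder_kantorovich_dist_le[OF law that]]) simp
  show ?thesis
    unfolding sg st mh
    using integrable_h 1 centred_integral(1) 2 stein_generator 3 4 by blast
qed

end
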